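(* Let $G$ be a finite group of order $n$ and let $P_G := \prod_{x \in G} o(x)$. Then $P_G \leq P_{C_n}$, with equality if and only if $G$ is cyclic.
   Context: $o(x)$ denotes the order of the element $x$; $C_n$ denotes the cyclic group of order $n$, and $P_{C_n} = \prod_{x\in C_n} o(x)$. *)

theory Defs
  imports "HOL-Algebra.Algebra"
begin

definition prod_orders :: "('a, 'b) monoid_scheme \<Rightarrow> nat" where
  "prod_orders G = (\<Prod>x\<in>carrier G. group.ord G x)"

end

theory Submission
  imports Defs "HOL-Number_Theory.Totient"
begin

text \<open>Let \<open>n\<close> be the order of \<open>G\<close>. The exponent of a prime \<open>p\<close> in the product of all element orders is the
  sum over \<open>k \<ge> 1\<close> with \<open>p ^ k\<close> dividing \<open>n\<close> of the number of elements whose order is divisible by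
  \<open>p ^ k\<close>. These are the elements that do not satisfy \<open>x ^ d = 1\<close>, where \<open>d = n / p ^ (a - k + 1)\<close>
  and \<open>p ^ a\<close> is the full power of \<open>p\<close> in \<open>n\<close>. By Frobenius' theorem the equation \<open>x ^ d = 1\<close> has at
  least \<open>d\<close> solutions, and exactly \<open>d\<close> in the cyclic group.

  In the case of equality, \<open>x ^ (n / p) = 1\<close> has exactly \<open>n / p\<close> solutions for every prime \<open>p\<close>
  dividing \<open>n\<close>. A count then yields a cyclic Sylow \<open>p\<close>-subgroup whose normalizer equals its
  centralizer, and Burnside's fusion argument shows that conjugate elements which commute are
  equal. A finite group with this property is abelian, and an abelian group with cyclic Sylow
  subgroups is cyclic.\<close>

subsection \<open>Conjugation and centralizers\<close>

text \<open>Frobenius' theorem is needed only for \<open>d = p ^ b * s\<close> with \<open>s\<close>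
  prime to \<open>p\<close>, where it splits into divisibility by the coprime numbers
  \<open>p ^ b\<close> and \<open>s\<close>. The first is elementary, because elements come in
  batches of generators of a cyclic subgroup. The second is the hard half; factoring elements into
  commuting parts turns it into an induction over centralizers, so that no quotient groups arise. In
  the case of equality the root counts are known for the whole group only and do not visibly pass to
  subgroups, so they cannot drive an induction. They are first converted into the statement that
  commuting conjugates are equal, which every subgroup inherits; this takes the place of transfer
  and normal complements. The conversion rests on a balance: elements whose order is divisible by
  the full power of \<open>p\<close> form exactly the fraction \<open>1 - 1/p\<close> of the
  extremal group, and Frobenius' theorem inside the centralizer of a suitable \<open>u\<close>
  bounds their fraction there by the same number.\<close>

definition roots :: "('a, 'b) monoid_scheme \<Rightarrow> nat \<Rightarrow> 'a set" where
  "roots G d = {x \<in> carrier G. x [^]\<^bsub>G\<^esub> d = \<one>\<^bsub>G\<^esub>}"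

definition conj_by :: "('a, 'b) monoid_scheme \<Rightarrow> 'a \<Rightarrow> 'a \<Rightarrow> 'a" where
  "conj_by G g x = g \<otimes>\<^bsub>G\<^esub> x \<otimes>\<^bsub>G\<^esub> inv\<^bsub>G\<^esub> g"

definition centralizer :: "('a, 'b) monoid_scheme \<Rightarrow> 'a \<Rightarrow> 'a set" where
  "centralizer G u = {g \<in> carrier G. g \<otimes>\<^bsub>G\<^esub> u = u \<otimes>\<^bsub>G\<^esub> g}"

context group
begin

lemma conj_by_closed [simp]:
  "g \<in> carrier G \<Longrightarrow> x \<in> carrier G \<Longrightarrow> conj_by G g x \<in> carrier G"
  by (simp add: conj_by_def)

lemma conj_by_mult:
  "g \<in> carrier G \<Longrightarrow> x \<in> carrier G \<Longrightarrow> y \<in> carrier G \<Longrightarrow>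
    conj_by G g (x \<otimes> y) = conj_by G g x \<otimes> conj_by G g y"
  by (simp add: conj_by_def m_assoc inv_solve_left)

lemma conj_by_conj_by:
  "g \<in> carrier G \<Longrightarrow> h \<in> carrier G \<Longrightarrow> x \<in> carrier G \<Longrightarrow>
    conj_by G g (conj_by G h x) = conj_by G (g \<otimes> h) x"
  by (simp add: conj_by_def m_assoc inv_mult_group)

lemma conj_by_one [simp]: "g \<in> carrier G \<Longrightarrow> conj_by G g \<one> = \<one>"
  by (simp add: conj_by_def)

lemma conj_by_one_left [simp]: "x \<in> carrier G \<Longrightarrow> conj_by G \<one> x = x"
  by (simp add: conj_by_def)

lemma conj_by_inv_cancel [simp]:
  assumes "g \<in> carrier G" "x \<in> carrier G"
  shows "conj_by G (inv g) (conj_by G g x) = x" "conj_by G g (conj_by G (inv g) x) = x"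
  using assms by (simp_all add: conj_by_conj_by)

lemma conj_by_cancel:
  "g \<in> carrier G \<Longrightarrow> x \<in> carrier G \<Longrightarrow> y \<in> carrier G \<Longrightarrow>
    conj_by G g x = conj_by G g y \<longleftrightarrow> x = y"
  by (metis conj_by_inv_cancel(1))

lemma conj_by_pow:
  "g \<in> carrier G \<Longrightarrow> x \<in> carrier G \<Longrightarrow> conj_by G g (x [^] (n::nat)) = conj_by G g x [^] n"
  by (induction n) (simp_all add: conj_by_mult)

lemma ord_conj_by:
  assumes "g \<in> carrier G" "x \<in> carrier G"
  shows "ord (conj_by G g x) = ord x"
proof -
  have "conj_by G g x [^] n = \<one> \<longleftrightarrow> x [^] n = \<one>" for n :: nat
    using assms by (metis conj_by_cancel conj_by_one conj_by_pow nat_pow_closed one_closed)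
  then show ?thesis
    using ord_unique[of "conj_by G g x" "ord x"] pow_eq_id[of x] assms by simp
qed

lemma conj_by_eq_iff:
  "g \<in> carrier G \<Longrightarrow> x \<in> carrier G \<Longrightarrow> conj_by G g x = x \<longleftrightarrow> g \<in> centralizer G x"
  by (auto simp: conj_by_def centralizer_def inv_solve_right')

lemma centralizer_sub: "centralizer G u \<subseteq> carrier G"
  by (auto simp: centralizer_def)

lemma finite_centralizer: "finite (carrier G) \<Longrightarrow> finite (centralizer G u)"
  using centralizer_sub finite_subset by blast

lemma centralizer_commute:
  "x \<in> carrier G \<Longrightarrow> y \<in> carrier G \<Longrightarrow> x \<in> centralizer G y \<longleftrightarrow> y \<in> centralizer G x"
  by (auto simp: centralizer_def)

lemma self_in_centralizer [simp]: "u \<in> carrier G \<Longrightarrow> u \<in> centralizer G u"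
  by (simp add: centralizer_def)

lemma centralizer_subgroup:
  assumes "u \<in> carrier G"
  shows "subgroup (centralizer G u) G"
proof (rule subgroupI)
  fix a assume "a \<in> centralizer G u"
  then have a: "a \<in> carrier G" "conj_by G a u = u"
    using assms conj_by_eq_iff centralizer_sub by blast+
  then have "conj_by G (inv a) u = u"
    by (metis assms conj_by_inv_cancel(1))
  then show "inv a \<in> centralizer G u"
    using a assms conj_by_eq_iff by simp
next
  fix a b assume "a \<in> centralizer G u" "b \<in> centralizer G u"
  then have "a \<in> carrier G" "b \<in> carrier G" "conj_by G a u = u" "conj_by G b u = u"
    using assms conj_by_eq_iff centralizer_sub by blast+
  then have "conj_by G (a \<otimes> b) u = u"
    by (metis assms conj_by_conj_by)
  then show "a \<otimes> b \<in> centralizer G u"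
    using \<open>a \<in> carrier G\<close> \<open>b \<in> carrier G\<close> assms conj_by_eq_iff by simp
next
  show "centralizer G u \<noteq> {}"
    using self_in_centralizer[OF assms] by blast
qed (rule centralizer_sub)

lemma centralizer_pow:
  assumes "u \<in> carrier G"
  shows "centralizer G u \<subseteq> centralizer G (u [^] (n::nat))"
proof
  fix g assume "g \<in> centralizer G u"
  then have g: "g \<in> carrier G" "conj_by G g u = u"
    using assms conj_by_eq_iff centralizer_sub by blast+
  then have "conj_by G g (u [^] n) = u [^] n"
    by (simp add: assms conj_by_pow)
  then show "g \<in> centralizer G (u [^] n)"
    using g assms conj_by_eq_iff by simp
qed

lemma conj_by_in_centralizer:
  assumes "g \<in> carrier G" "x \<in> carrier G" "u \<in> carrier G"
  shows "conj_by G g x \<in> centralizer G (conj_by G g u) \<longleftrightarrow> x \<in> centralizer G u"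
  using assms by (simp add: centralizer_def conj_by_cancel flip: conj_by_mult)

lemma bij_betw_centralizer_conj_by:
  assumes "g \<in> carrier G" "u \<in> carrier G"
  shows "bij_betw (conj_by G g) (centralizer G u) (centralizer G (conj_by G g u))"
proof (rule bij_betw_byWitness [where f' = "conj_by G (inv g)"])
  show "conj_by G g ` centralizer G u \<subseteq> centralizer G (conj_by G g u)"
    using assms centralizer_sub conj_by_in_centralizer by blast
  show "conj_by G (inv g) ` centralizer G (conj_by G g u) \<subseteq> centralizer G u"
    using assms centralizer_sub[of "conj_by G g u"] conj_by_in_centralizer[of "inv g" _ "conj_by G g u"]
    by auto
qed (use assms centralizer_sub in \<open>auto dest!: subsetD[OF centralizer_sub]\<close>)

lemma card_conjugacy_class:
  assumes "u \<in> carrier G"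
  shows "card ((\<lambda>g. conj_by G g u) ` carrier G) * card (centralizer G u) = order G"
proof -
  interpret act: group_action G "carrier G" "\<lambda>g. \<lambda>h\<in>carrier G. g \<otimes> h \<otimes> inv g"
    by (rule action_by_conjugation)
  have "orbit G (\<lambda>g. \<lambda>h\<in>carrier G. g \<otimes> h \<otimes> inv g) u = (\<lambda>g. conj_by G g u) ` carrier G"
    using assms by (auto simp: orbit_def conj_by_def)
  moreover have "stabilizer G (\<lambda>g. \<lambda>h\<in>carrier G. g \<otimes> h \<otimes> inv g) u = centralizer G u"
    using assms conj_by_eq_iff by (auto simp: stabilizer_def centralizer_def conj_by_def)
  ultimately show ?thesis
    using act.orbit_stabilizer_theorem[OF assms] by simp
qed

text \<open>\<open>U\<close> is a union of conjugacy classes on each of which \<open>F\<close> is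
  constant, so a class contributes its size times a single value of \<open>F\<close>.\<close>

lemma dvd_sum_conjugation_invariant:
  fixes F :: "'a \<Rightarrow> nat"
  assumes fin: "finite (carrier G)" and U: "U \<subseteq> carrier G"
    and inv_U: "\<And>g u. g \<in> carrier G \<Longrightarrow> u \<in> U \<Longrightarrow> conj_by G g u \<in> U"
    and inv_F: "\<And>g u. g \<in> carrier G \<Longrightarrow> u \<in> U \<Longrightarrow> F (conj_by G g u) = F u"
    and dvd: "\<And>u. u \<in> U \<Longrightarrow> s dvd card ((\<lambda>g. conj_by G g u) ` carrier G) * F u"
  shows "s dvd sum F U"
proof -
  interpret act: group_action G "carrier G" "\<lambda>g. \<lambda>h\<in>carrier G. g \<otimes> h \<otimes> inv g"
    by (rule action_by_conjugation)
  let ?orb = "orbits G (carrier G) (\<lambda>g. \<lambda>h\<in>carrier G. g \<otimes> h \<otimes> inv g)"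
  \<comment> \<open>\<open>act.disjoint_sum\<close> decomposes a sum over the whole carrier, hence
    the extension of \<open>F\<close> by zero; classes outside \<open>U\<close> contribute
    nothing.\<close>
  define F' where "F' x = (if x \<in> U then F x else 0)" for x
  have orb: "\<exists>u\<in>carrier G. B = (\<lambda>g. conj_by G g u) ` carrier G" if "B \<in> ?orb" for B
  proof -
    have "\<exists>u. B = orbit G (\<lambda>g. \<lambda>h\<in>carrier G. g \<otimes> h \<otimes> inv g) u \<and> u \<in> carrier G"
      using that unfolding orbits_def by (rule CollectD)
    then obtain u where u: "B = orbit G (\<lambda>g. \<lambda>h\<in>carrier G. g \<otimes> h \<otimes> inv g) u" "u \<in> carrier G"
      by (elim exE conjE)
    have "orbit G (\<lambda>g. \<lambda>h\<in>carrier G. g \<otimes> h \<otimes> inv g) u = (\<lambda>g. conj_by G g u) ` carrier G"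
      using u(2) by (auto simp: orbit_def conj_by_def)
    then show ?thesis
      using u(2) unfolding u(1) by (rule bexI)
  qed
  have "s dvd (\<Sum>x\<in>B. F' x)" if B: "B \<in> ?orb" for B
  proof -
    obtain u where u: "u \<in> carrier G" "B = (\<lambda>g. conj_by G g u) ` carrier G"
      using orb[OF B] by blast
    show ?thesis
    proof (cases "u \<in> U")
      case True
      then have "(\<Sum>x\<in>B. F' x) = (\<Sum>x\<in>B. F u)"
        using u inv_U inv_F by (intro sum.cong) (auto simp: F'_def)
      also have "\<dots> = card B * F u"
        by simp
      finally show ?thesis
        using dvd[OF True] u(2) by simp
    next
      case False
      have "x \<notin> U" if xB: "x \<in> B" for x
      proof
        assume "x \<in> U"
        obtain g where g: "g \<in> carrier G" "x = conj_by G g u"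
          using xB u by blast
        then have "conj_by G (inv g) x = u"
          using u by simp
        then show False
          using inv_U[OF inv_closed[OF g(1)] \<open>x \<in> U\<close>] False by simp
      qed
      then show ?thesis
        by (simp add: F'_def)
    qed
  qed
  then have "s dvd (\<Sum>x\<in>carrier G. F' x)"
    by (simp only: dvd_sum flip: act.disjoint_sum[OF fin, of F'])
  also have "(\<Sum>x\<in>carrier G. F' x) = sum F U"
    using U fin by (simp add: F'_def sum.If_cases Int_absorb1)
  finally show ?thesis .
qed

lemma mem_roots_iff_ord_dvd: "x \<in> carrier G \<Longrightarrow> x \<in> roots G d \<longleftrightarrow> ord x dvd d"
  by (simp add: roots_def pow_eq_id)

lemma roots_sub: "roots G d \<subseteq> carrier G"
  by (auto simp: roots_def)

lemma roots_subgroup_eq: "H \<subseteq> carrier G \<Longrightarrow> roots (G\<lparr>carrier := H\<rparr>) d = roots G d \<inter> H"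
  unfolding roots_def by (simp flip: nat_pow_consistent) blast

lemma conj_by_mem_roots:
  "g \<in> carrier G \<Longrightarrow> x \<in> carrier G \<Longrightarrow> conj_by G g x \<in> roots G d \<longleftrightarrow> x \<in> roots G d"
  by (simp add: mem_roots_iff_ord_dvd ord_conj_by)

end

subsection \<open>The number of solutions of \<open>x ^ d = 1\<close>\<close>

text \<open>Chinese remainder idempotents: if the order of \<open>x\<close> divides
  \<open>m * s\<close>, the powers of \<open>x\<close> with exponents \<open>e\<close> and
  \<open>f\<close> are its \<open>m\<close>-part and its \<open>s\<close>-part.\<close>

lemma coprime_split_exponents:
  fixes m s :: nat
  assumes "coprime m s"
  obtains e f where "s dvd e" "m dvd f" "[e = 1] (mod m)" "[f = 1] (mod s)"
proof -
  obtain e where "[e = 1] (mod m)" "[e = 0] (mod s)"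
    using binary_chinese_remainder_nat[OF assms] by blast
  moreover obtain f where "[f = 0] (mod m)" "[f = 1] (mod s)"
    using binary_chinese_remainder_nat[OF assms] by blast
  ultimately show ?thesis
    using that by (simp add: cong_0_iff)
qed

context group
begin

lemma pow_cong_roots:
  assumes "x \<in> roots G d" "[i = j] (mod d)"
  shows "x [^] i = x [^] j"
proof -
  have x: "x \<in> carrier G" "x [^] d = \<one>"
    using assms by (auto simp: roots_def)
  have "x [^] k = x [^] (k mod d)" for k :: nat
  proof -
    have "x [^] k = x [^] (d * (k div d)) \<otimes> x [^] (k mod d)"
      by (metis mult_div_mod_eq nat_pow_mult x(1))
    also have "x [^] (d * (k div d)) = \<one>"
      by (metis nat_pow_one nat_pow_pow x)
    finally show ?thesis
      using x by simp
  qed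
  then show ?thesis
    using assms(2) by (metis cong_def)
qed

lemma pow_dvd_roots: "x \<in> roots G d \<Longrightarrow> d dvd k \<Longrightarrow> x [^] k = \<one>"
  using pow_cong_roots[of x d k 0] by (simp add: cong_0_iff)

lemma roots_mono: "d dvd k \<Longrightarrow> roots G d \<subseteq> roots G k"
  by (auto simp: roots_def pow_eq_id intro: dvd_trans)

lemma roots_order: "roots G (order G) = carrier G"
  by (auto simp: roots_def pow_order_eq_1)

lemma pow_mem_roots: "x \<in> carrier G \<Longrightarrow> x [^] i \<in> roots G d \<longleftrightarrow> ord x dvd i * d"
  by (simp add: roots_def nat_pow_pow pow_eq_id)

text \<open>Every element of order dividing \<open>m * s\<close> factors uniquely into commuting elements of
  \<open>roots G m\<close> and \<open>roots G s\<close>; so the fibre of \<open>u\<close> is counted by the second factors, which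
  range over the centralizer of \<open>u\<close>.\<close>

lemma card_coprime_part_fibre:
  assumes ord: "order G = m * s" and u: "u \<in> roots G m"
    and e: "s dvd e" "[e = 1] (mod m)" and f: "m dvd f" "[f = 1] (mod s)" and cop: "coprime m s"
  shows "card {x \<in> carrier G. x [^] e = u} = card (roots G s \<inter> centralizer G u)"
proof -
  have [simp]: "u \<in> carrier G"
    using u roots_sub by blast
  have "[e + f = 1] (mod m)" "[e + f = 1] (mod s)"
    using e f by (metis add.right_neutral cong_0_iff cong_add, metis add.left_neutral cong_0_iff cong_add)
  then have "[e + f = 1] (mod m * s)"
    using cop by (rule coprime_cong_mult_nat)
  then have split: "x [^] e \<otimes> x [^] f = x" if "x \<in> carrier G" for x
    using pow_cong_roots[of x "order G" "e + f" 1] \<open>[e + f = 1] (mod m * s)\<close> that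
    by (simp add: roots_order ord nat_pow_mult del: One_nat_def) (simp add: roots_order flip: ord)
  have "bij_betw (\<lambda>x. x [^] f) {x \<in> carrier G. x [^] e = u} (roots G s \<inter> centralizer G u)"
  proof (rule bij_betw_byWitness [where f' = "\<lambda>w. u \<otimes> w"])
    show "\<forall>x\<in>{x \<in> carrier G. x [^] e = u}. u \<otimes> x [^] f = x"
      using split by auto
    have *: "(u \<otimes> w) [^] f = w" "(u \<otimes> w) [^] e = u" if w: "w \<in> roots G s \<inter> centralizer G u" for w
    proof -
      have w': "w \<in> carrier G" "u \<otimes> w = w \<otimes> u"
        using w by (auto simp: centralizer_def)
      have "w [^] f = w" "w [^] e = \<one>"
        using w e f w' pow_cong_roots[of w s f 1] pow_dvd_roots[of w s e] by auto
      moreover have "u [^] e = u" "u [^] f = \<one>"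
        using u e f pow_cong_roots[of u m e 1] pow_dvd_roots[of u m f] by auto
      ultimately show "(u \<otimes> w) [^] f = w" "(u \<otimes> w) [^] e = u"
        using w' pow_mult_distrib by auto
    qed
    then show "\<forall>w\<in>roots G s \<inter> centralizer G u. (u \<otimes> w) [^] f = w"
      by blast
    show "(\<lambda>x. x [^] f) ` {x \<in> carrier G. x [^] e = u} \<subseteq> roots G s \<inter> centralizer G u"
    proof clarify
      fix x assume x: "x \<in> carrier G" "u = x [^] e"
      have "ord x dvd f * s"
        using ord_dvd_group_order[OF x(1)] ord f(1) by (metis dvd_trans mult_dvd_mono dvd_refl)
      moreover have "x [^] f \<in> centralizer G (x [^] e)"
        using x by (simp add: centralizer_def nat_pow_mult add.commute)
      ultimately show "x [^] f \<in> roots G s \<inter> centralizer G (x [^] e)"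
        using x by (simp add: pow_mem_roots)
    qed
    show "(\<otimes>) u ` (roots G s \<inter> centralizer G u) \<subseteq> {x \<in> carrier G. x [^] e = u}"
    proof (rule image_subsetI)
      fix w assume w: "w \<in> roots G s \<inter> centralizer G u"
      then have "w \<in> carrier G" using roots_sub by blast
      then show "u \<otimes> w \<in> {x \<in> carrier G. x [^] e = u}"
        using *(2)[OF w] by simp
    qed
  qed
  then show ?thesis
    by (rule bij_betw_same_card)
qed

text \<open>Elements are sorted by their \<open>m\<close>-part \<open>x [^] e\<close>. Taking
  \<open>d = m\<close> counts the whole group; proper divisors \<open>d\<close> give the
  intermediate root sets.\<close>

lemma card_roots_mult_eq_sum:
  assumes fin: "finite (carrier G)" and ord: "order G = m * s" and cop: "coprime m s" and d: "d dvd m"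
  shows "card (roots G (d * s)) = (\<Sum>u\<in>roots G d. card (roots G s \<inter> centralizer G u))"
proof -
  obtain e f where ef: "s dvd e" "m dvd f" "[e = 1] (mod m)" "[f = 1] (mod s)"
    using coprime_split_exponents[OF cop] .
  have "coprime e m"
    using ef(3) by (metis cong_imp_coprime cong_sym coprime_1_left)
  have *: "x \<in> roots G (d * s) \<longleftrightarrow> x [^] e \<in> roots G d" if x: "x \<in> carrier G" for x
  proof -
    have "ord x dvd e * d \<longleftrightarrow> ord x dvd d * s"
    proof
      assume "ord x dvd e * d"
      moreover have "ord x dvd m * s"
        using ord_dvd_group_order[OF x] ord by simp
      ultimately have "ord x dvd gcd (e * d) (m * s)"
        by simp
      \<comment> \<open>Once \<open>d * s\<close> is extracted, the cofactors of \<open>e\<close>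
        and \<open>m\<close> are coprime because \<open>e\<close> is prime to
        \<open>m\<close>.\<close>
      also have "gcd (e * d) (m * s) dvd d * s"
      proof -
        obtain e' where e': "e = s * e'" using ef(1) by auto
        obtain d' where d': "m = d * d'" using d by auto
        have "gcd (e * d) (m * s) = gcd (e' * (s * d)) (d' * (s * d))"
          by (simp add: e' d' mult_ac)
        also have "\<dots> = gcd e' d' * (s * d)"
          by (metis gcd_mult_distrib_nat mult.commute)
        also have "gcd e' d' = 1"
          using \<open>coprime e m\<close> by (simp add: e' d')
        finally show ?thesis by (simp add: mult.commute)
      qed
      finally show "ord x dvd d * s" .
    next
      assume "ord x dvd d * s"
      then show "ord x dvd e * d"
        using ef(1) by (metis dvd_trans mult.commute mult_dvd_mono dvd_refl)
    qed
    then show ?thesis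
      using x pow_mem_roots[OF x] mem_roots_iff_ord_dvd[OF x] by blast
  qed
  have "roots G (d * s) = (\<Union>u\<in>roots G d. {x \<in> carrier G. x [^] e = u})"
    using * roots_sub by blast
  also have "card \<dots> = (\<Sum>u\<in>roots G d. card {x \<in> carrier G. x [^] e = u})"
    using fin finite_subset[OF roots_sub fin] by (intro card_UN_disjoint) auto
  also have "\<dots> = (\<Sum>u\<in>roots G d. card (roots G s \<inter> centralizer G u))"
    using card_coprime_part_fibre[OF ord _ ef(1,3,2,4) cop] roots_mono[OF d]
    by (intro sum.cong) auto
  finally show ?thesis .
qed

section \<open>Divisibility by the part of the order prime to \<open>p\<close>\<close>

lemma card_roots_centralizer_conj_by:
  assumes "g \<in> carrier G" "u \<in> carrier G"
  shows "card (roots G s \<inter> centralizer G (conj_by G g u)) = card (roots G s \<inter> centralizer G u)"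
proof -
  have "bij_betw (conj_by G g) (roots G s \<inter> centralizer G u) (roots G s \<inter> centralizer G (conj_by G g u))"
  proof (rule bij_betw_byWitness [where f' = "conj_by G (inv g)"])
    show "conj_by G g ` (roots G s \<inter> centralizer G u) \<subseteq> roots G s \<inter> centralizer G (conj_by G g u)"
      using assms centralizer_sub conj_by_in_centralizer conj_by_mem_roots by blast
    show "conj_by G (inv g) ` (roots G s \<inter> centralizer G (conj_by G g u)) \<subseteq> roots G s \<inter> centralizer G u"
      using assms centralizer_sub[of "conj_by G g u"] conj_by_in_centralizer[of "inv g" _ "conj_by G g u"]
        conj_by_mem_roots by auto
  qed (use assms in \<open>auto dest!: subsetD[OF centralizer_sub]\<close>)
  then show ?thesis
    by (simp add: bij_betw_same_card)
qed

lemma order_subgroup_carrier [simp]: "order (G\<lparr>carrier := H\<rparr>) = card H"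
  by (simp add: order_def)

lemma card_subgroup_dvd: "subgroup H G \<Longrightarrow> card H dvd order G"
  using lagrange by (metis dvd_triv_right)

text \<open>Cauchy's argument: a common prime \<open>q\<close> gives a nontrivial element of
  \<open>H\<close> whose order divides both \<open>q\<close> and \<open>m\<close>, although
  \<open>q\<close> divides \<open>s\<close>.\<close>

lemma coprime_card_subgroup_of_roots:
  assumes fin: "finite (carrier G)" and H: "subgroup H G" "H \<subseteq> roots G m" and cop: "coprime m s"
  shows "coprime (card H) s"
proof (rule ccontr)
  assume "\<not> coprime (card H) s"
  then obtain q where q: "Factorial_Ring.prime q" "q dvd card H" "q dvd s"
    using prime_factor_nat[of "gcd (card H) s"]
    by (metis coprime_iff_gcd_eq_1 dvd_trans gcd_dvd1 gcd_dvd2)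
  then obtain k where "card H = q ^ 1 * k" by auto
  moreover have fH: "finite H" using H fin roots_sub by (meson finite_subset)
  ultimately obtain Q where "subgroup Q (G\<lparr>carrier := H\<rparr>)" "card Q = q ^ 1"
    using sylow_thm[OF q(1) subgroup_imp_group[OF H(1)], of 1 k] by auto
  then have Q: "subgroup Q G" "Q \<subseteq> H" "card Q = q"
    using incl_subgroup[OF H(1)] subgroup.subset by fastforce+
  then have "Q \<noteq> {\<one>}"
    using prime_gt_1_nat[OF q(1)] by auto
  then obtain x where x: "x \<in> Q" "x \<noteq> \<one>"
    using subgroup.one_closed[OF Q(1)] by blast
  have xc: "x \<in> carrier G" using x Q H subgroup.subset by blast
  interpret Q: group "G\<lparr>carrier := Q\<rparr>" by (rule subgroup_imp_group[OF Q(1)])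
  have "x [^] q = \<one>"
    using Q.pow_order_eq_1[of x] x Q by (simp flip: nat_pow_consistent)
  moreover have "x [^] m = \<one>"
    using x Q H by (auto simp: roots_def)
  ultimately have "ord x dvd gcd q m"
    using xc by (simp add: pow_eq_id)
  moreover have "coprime q m"
    using cop q(3) by (metis coprime_commute coprime_divisors dvd_refl)
  ultimately show False
    using x xc ord_eq_1 by (metis coprime_iff_gcd_eq_1 nat_dvd_1_iff_1)
qed

end

text \<open>A class size times the prime-to-\<open>p\<close> part \<open>t\<close> of the
  centralizer order is a multiple of \<open>s\<close>, and \<open>IH\<close> supplies the factor
  \<open>t\<close> in the summand. Keeping \<open>IH\<close> abstract serves two uses: within the
  induction for noncentral \<open>u\<close>, and afterwards for all \<open>u\<close> with the
  finished result.\<close>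

lemma (in group) dvd_sum_card_roots_centralizer:
  assumes fin: "finite (carrier G)" and ord: "order G = p ^ a * s"
    and p: "Factorial_Ring.prime p" "\<not> p dvd s"
    and U: "U \<subseteq> carrier G" "\<And>g u. g \<in> carrier G \<Longrightarrow> u \<in> U \<Longrightarrow> conj_by G g u \<in> U"
    and IH: "\<And>u b t. u \<in> U \<Longrightarrow> card (centralizer G u) = p ^ b * t \<Longrightarrow> \<not> p dvd t \<Longrightarrow>
      t dvd card (roots G t \<inter> centralizer G u)"
  shows "s dvd (\<Sum>u\<in>U. card (roots G s \<inter> centralizer G u))"
proof (rule dvd_sum_conjugation_invariant[OF fin U])
  fix u assume uU: "u \<in> U"
  then have u: "u \<in> carrier G" using U by blast
  let ?C = "centralizer G u" and ?k = "card ((\<lambda>g. conj_by G g u) ` carrier G)"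
  have cl: "?k * card ?C = p ^ a * s"
    using card_conjugacy_class[OF u] ord by simp
  have "p ^ a * s > 0" using fin ord order_gt_0_iff_finite by metis
  have C0: "card ?C \<noteq> 0" using cl \<open>p ^ a * s > 0\<close> by (metis mult_0_right less_irrefl)
  obtain b t where t: "card ?C = p ^ b * t" "\<not> p dvd t"
    using multiplicity_decompose'[OF C0, of p] not_prime_unit p(1) by metis
  have ct: "coprime t (p ^ i)" "coprime s (p ^ i)" for i
    using t(2) p by (simp_all add: coprime_commute prime_imp_coprime)
  have "t dvd p ^ a * s"
    unfolding cl[symmetric] t(1) by simp
  then have ts: "t dvd s"
    by (rule iffD1[OF coprime_dvd_mult_right_iff[OF ct(1)]])
  \<comment> \<open>Orders in \<open>?C\<close> divide \<open>p ^ b * t\<close>, so those dividing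
    \<open>s\<close> are prime to \<open>p\<close> and divide \<open>t\<close>.\<close>
  have "roots G s \<inter> ?C = roots G t \<inter> ?C"
  proof (intro equalityI subsetI)
    fix x assume x: "x \<in> roots G s \<inter> ?C"
    interpret C: group "G\<lparr>carrier := ?C\<rparr>"
      by (rule subgroup_imp_group[OF centralizer_subgroup[OF u]])
    have xc: "x \<in> carrier G" using x centralizer_sub by blast
    have "ord x dvd card ?C"
      using C.pow_order_eq_1[of x] x xc by (simp add: pow_eq_id flip: nat_pow_consistent)
    moreover have xs: "ord x dvd s" using x xc mem_roots_iff_ord_dvd by blast
    moreover have "coprime (ord x) (p ^ b)"
      using coprime_divisors[OF xs dvd_refl ct(2)] .
    ultimately have "ord x dvd t"
      unfolding t(1) using coprime_dvd_mult_right_iff by blast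
    then show "x \<in> roots G t \<inter> ?C"
      using x xc mem_roots_iff_ord_dvd by blast
  qed (use roots_mono[OF ts] in blast)
  then have tF: "t dvd card (roots G s \<inter> ?C)"
    using IH[OF uU t] by simp
  \<comment> \<open>The class equation gives the multiple of \<open>s\<close>; the power of
    \<open>p\<close> is then cancelled.\<close>
  have "s dvd ?k * t * p ^ b"
    using cl unfolding t(1) by (metis dvd_triv_right mult.assoc mult.commute)
  then have "s dvd ?k * t"
    by (rule iffD1[OF coprime_dvd_mult_left_iff[OF ct(2)]])
  then show "s dvd ?k * card (roots G s \<inter> ?C)"
    using tF by (meson dvd_refl dvd_trans mult_dvd_mono)
next
  fix g u assume "g \<in> carrier G" "u \<in> U"
  then show "card (roots G s \<inter> centralizer G (conj_by G g u)) = card (roots G s \<inter> centralizer G u)"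
    using card_roots_centralizer_conj_by U(1) by blast
qed

text \<open>Centrality is what makes roots closed under products. Besides isolating the central
  \<open>p\<close>-elements, the exponent \<open>order G\<close> yields the whole centre.\<close>

lemma (in group) central_roots_subgroup:
  "subgroup {u \<in> roots G m. centralizer G u = carrier G} G"
proof -
  let ?Z = "{u \<in> roots G m. centralizer G u = carrier G}"
  have Z: "u \<in> ?Z \<longleftrightarrow> u \<in> carrier G \<and> u [^] m = \<one> \<and> (\<forall>g\<in>carrier G. u \<in> centralizer G g)" for u
  proof -
    have "centralizer G u = carrier G \<longleftrightarrow> (\<forall>g\<in>carrier G. u \<in> centralizer G g)" if "u \<in> carrier G"
      using that centralizer_commute[OF that] centralizer_sub[of u] by blast
    then show ?thesis
      unfolding roots_def by blast
  qed
  show ?thesis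
  proof (rule subgroupI)
    fix u v assume "u \<in> ?Z" "v \<in> ?Z"
    then have uv: "u \<in> carrier G" "u [^] m = \<one>" "v \<in> carrier G" "v [^] m = \<one>"
      "\<And>g. g \<in> carrier G \<Longrightarrow> u \<in> centralizer G g \<and> v \<in> centralizer G g"
      unfolding Z by blast+
    have "u \<otimes> v = v \<otimes> u"
      using uv(5)[OF uv(3)] by (simp add: centralizer_def)
    then have "(u \<otimes> v) [^] m = \<one>"
      using uv(1-4) pow_mult_distrib by simp
    moreover have "u \<otimes> v \<in> centralizer G g" if "g \<in> carrier G" for g
      using subgroup.m_closed[OF centralizer_subgroup[OF that]] uv(5)[OF that] by blast
    ultimately show "u \<otimes> v \<in> ?Z"
      unfolding Z using uv(1,3) by blast
  next
    fix u assume "u \<in> ?Z"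
    then have u: "u \<in> carrier G" "u [^] m = \<one>" "\<And>g. g \<in> carrier G \<Longrightarrow> u \<in> centralizer G g"
      unfolding Z by blast+
    moreover have "inv u \<in> centralizer G g" if "g \<in> carrier G" for g
      using subgroup.m_inv_closed[OF centralizer_subgroup[OF that]] u(3)[OF that] by blast
    moreover have "inv u [^] m = \<one>"
      using u by (simp add: nat_pow_inv)
    ultimately show "inv u \<in> ?Z"
      unfolding Z by blast
  next
    have "\<one> \<in> ?Z"
      unfolding Z by (simp add: centralizer_def)
    then show "?Z \<noteq> {}"
      by blast
  qed (use roots_sub in blast)
qed

text \<open>Class sums over the noncentral \<open>p\<close>-elements are divisible by \<open>s\<close> by induction, and each
  central one contributes the same number of \<open>s\<close>-th roots of unity; the number of central
  \<open>p\<close>-elements is prime to \<open>s\<close>.\<close>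

lemma p'_part_dvd_card_roots:
  assumes "group G" "finite (carrier G)" "order G = p ^ a * s" "Factorial_Ring.prime p" "\<not> p dvd s"
  shows "s dvd card (roots G s)"
  using assms
proof (induction "order G" arbitrary: G a s rule: less_induct)
  case (less G a s)
  interpret group G by fact
  note fin = less.prems(2) and ord = less.prems(3) and p = less.prems(4,5)
  let ?R = "roots G (p ^ a)"
  let ?Z = "{u \<in> ?R. centralizer G u = carrier G}"
  let ?F = "\<lambda>u. card (roots G s \<inter> centralizer G u)"
  have cop: "coprime (p ^ a) s"
    using p by (simp add: prime_imp_coprime)
  have finR: "finite ?R" using fin roots_sub finite_subset by blast
  have "p ^ a * s = (\<Sum>u\<in>?R. ?F u)"
    using card_roots_mult_eq_sum[OF fin ord cop dvd_refl] roots_order unfolding ord[symmetric] order_def by simp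
  also have "\<dots> = (\<Sum>u\<in>?R - ?Z. ?F u) + (\<Sum>u\<in>?Z. ?F u)"
    using finR by (intro sum.subset_diff) auto
  also have "(\<Sum>u\<in>?Z. ?F u) = card ?Z * card (roots G s)"
  proof -
    have "?F u = card (roots G s)" if "u \<in> ?Z" for u
      using that roots_sub[of s] by (simp add: Int_absorb2)
    then show ?thesis by simp
  qed
  finally have "p ^ a * s = (\<Sum>u\<in>?R - ?Z. ?F u) + card ?Z * card (roots G s)" .
  moreover have "s dvd (\<Sum>u\<in>?R - ?Z. ?F u)"
  proof (rule dvd_sum_card_roots_centralizer[OF fin ord p])
    show "?R - ?Z \<subseteq> carrier G" using roots_sub by blast
    fix g u assume g: "g \<in> carrier G" and u: "u \<in> ?R - ?Z"
    then have uc: "u \<in> carrier G" using roots_sub by blast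
    have "bij_betw (conj_by G g) (centralizer G u) (centralizer G (conj_by G g u))"
      using bij_betw_centralizer_conj_by g uc by blast
    then have "card (centralizer G (conj_by G g u)) = card (centralizer G u)"
      by (simp add: bij_betw_same_card)
    moreover have "centralizer G u \<subset> carrier G"
      using u centralizer_sub by blast
    then have "card (centralizer G u) < card (carrier G)"
      using fin by (rule psubset_card_mono[rotated])
    ultimately have "centralizer G (conj_by G g u) \<noteq> carrier G"
      by auto
    then show "conj_by G g u \<in> ?R - ?Z"
      using g u uc conj_by_mem_roots by auto
  next
    fix u b t assume u: "u \<in> ?R - ?Z" and t: "card (centralizer G u) = p ^ b * t" "\<not> p dvd t"
    then have uc: "u \<in> carrier G" using roots_sub by blast
    let ?C = "G\<lparr>carrier := centralizer G u\<rparr>"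
    have "centralizer G u \<subset> carrier G" using u centralizer_sub by blast
    then have "order ?C < order G"
      using fin psubset_card_mono by (simp add: order_def)
    then have "t dvd card (roots ?C t)"
      using less.hyps[of ?C b t] subgroup_imp_group[OF centralizer_subgroup[OF uc]]
        finite_centralizer[OF fin] t p by simp
    then show "t dvd card (roots G t \<inter> centralizer G u)"
      using roots_subgroup_eq[OF centralizer_sub] by simp
  qed
  ultimately have "s dvd card ?Z * card (roots G s)"
    using dvd_add_right_iff[of s] dvd_triv_right[of s "p ^ a"] by auto
  moreover have "coprime s (card ?Z)"
    using coprime_card_subgroup_of_roots[OF fin central_roots_subgroup _ cop]
    by (simp add: coprime_commute)
  ultimately show ?case
    using coprime_dvd_mult_right_iff by blast
qed

section \<open>Frobenius' theorem for divisors of prime power index\<close>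

lemma (in group) card_same_generate:
  assumes fin: "finite (carrier G)" and x: "x \<in> carrier G"
  shows "card {y \<in> carrier G. generate G {y} = generate G {x}} = totient (ord x)"
proof -
  have pos: "ord x > 0" using ord_ge_1[OF fin x] by simp
  have finG: "finite (generate G {x})"
    using generate_incl[of "{x}"] x fin finite_subset by blast
  have gen_pow: "generate G {y} = {y [^] k | k. k \<in> (UNIV::nat set)}" if "y \<in> carrier G" for y
    using generate_pow_on_finite_carrier[OF fin that] .
  \<comment> \<open>The generators of the subgroup generated by \<open>x\<close> are the powers of
    \<open>x\<close> with exponent prime to \<open>ord x\<close>.\<close>
  have "bij_betw (\<lambda>k. x [^] k) (totatives (ord x)) {y \<in> carrier G. generate G {y} = generate G {x}}"
  proof (rule bij_betw_imageI)
    show "inj_on (\<lambda>k. x [^] k) (totatives (ord x))"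
      by (rule inj_on_subset[OF ord_inj'[OF x]]) (auto simp: totatives_def)
    show "(\<lambda>k. x [^] k) ` totatives (ord x) = {y \<in> carrier G. generate G {y} = generate G {x}}"
    proof (intro equalityI subsetI)
      fix y assume "y \<in> (\<lambda>k. x [^] k) ` totatives (ord x)"
      then obtain k where k: "y = x [^] k" "coprime k (ord x)"
        by (auto simp: totatives_def)
      then have y: "y \<in> carrier G" "ord y = ord x"
        using x pow_ord_eq_ord_iff[OF fin x] by auto
      have "generate G {y} \<subseteq> generate G {x}"
        using gen_pow[OF x] gen_pow[OF y(1)] k x by (auto simp: nat_pow_pow)
      then have "generate G {y} = generate G {x}"
        using generate_pow_card[OF x] generate_pow_card[OF y(1)] y(2) finG card_subset_eq by metis
      then show "y \<in> {y \<in> carrier G. generate G {y} = generate G {x}}"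
        using y by blast
    next
      fix y assume "y \<in> {y \<in> carrier G. generate G {y} = generate G {x}}"
      then have y: "y \<in> carrier G" "generate G {y} = generate G {x}" by auto
      then have "y \<in> generate G {x}" by (metis generate.incl insertI1)
      then obtain k where k: "y = x [^] (k::nat)"
        using gen_pow[OF x] by blast
      have "ord y = ord x"
        using y x generate_pow_card by metis
      then have "coprime k (ord x)"
        using k pow_ord_eq_ord_iff[OF fin x] by blast
      then have 1: "coprime (k mod ord x) (ord x)"
        by (metis coprime_mod_left_iff pos less_not_refl)
      have "x \<in> roots G (ord x)" using x by (simp add: roots_def)
      then have 2: "y = x [^] (k mod ord x)"
        unfolding k by (rule pow_cong_roots) (simp add: cong_def)
      show "y \<in> (\<lambda>k. x [^] k) ` totatives (ord x)"
      \<comment> \<open>Totatives start at 1, so residue 0 needs separate care: it is prime to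
        \<open>ord x\<close> only when \<open>ord x = 1\<close>.\<close>
      proof (cases "k mod ord x = 0")
        case True
        then have "ord x = 1" using 1 by simp
        then have "x = \<one>" using x ord_eq_1 by blast
        then show ?thesis using k by (auto simp: totatives_def)
      next
        case False
        then show ?thesis using 1 2 pos by (auto simp: totatives_def intro!: less_imp_le)
      qed
    qed
  qed
  then show ?thesis
    by (simp add: bij_betw_same_card totient_def)
qed

text \<open>The elements generating a common cyclic subgroup of order \<open>k\<close> number \<open>totient k\<close>.\<close>

lemma (in group) totient_dvd_card_ord_multiple:
  assumes fin: "finite (carrier G)"
  shows "totient m dvd card {x \<in> carrier G. m dvd ord x}"
proof -
  let ?S = "{x \<in> carrier G. m dvd ord x}"
  have finS: "finite ?S" using fin by simp
  have "card ?S = (\<Sum>H\<in>(\<lambda>x. generate G {x}) ` ?S. card {x \<in> ?S. generate G {x} = H})"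
    using sum.image_gen[OF finS, of "\<lambda>_. 1::nat" "\<lambda>x. generate G {x}"] by simp
  also have "totient m dvd \<dots>"
  proof (rule dvd_sum)
    fix H assume "H \<in> (\<lambda>x. generate G {x}) ` ?S"
    then obtain x where x: "x \<in> carrier G" "m dvd ord x" "H = generate G {x}" by blast
    have "{y \<in> ?S. generate G {y} = H} = {y \<in> carrier G. generate G {y} = generate G {x}}"
      using x generate_pow_card by fastforce
    then show "totient m dvd card {y \<in> ?S. generate G {y} = H}"
      using card_same_generate[OF fin x(1)] totient_dvd[OF x(2)] by simp
  qed
  finally show ?thesis .
qed

text \<open>All orders divide \<open>p ^ a * s\<close>, so only the power of \<open>p\<close> in an
  order can prevent it from dividing \<open>p ^ b * s\<close>.\<close>

lemma (in group) roots_eq_Diff_ord_multiple: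
  assumes fin: "finite (carrier G)" and ord: "order G = p ^ a * s" and b: "b < a"
    and p: "Factorial_Ring.prime p" "\<not> p dvd s"
  shows "roots G (p ^ b * s) = carrier G - {x \<in> carrier G. p ^ Suc b dvd ord x}"
proof -
  have "ord x dvd p ^ b * s \<longleftrightarrow> \<not> p ^ Suc b dvd ord x" if x: "x \<in> carrier G" for x
  proof
    assume "ord x dvd p ^ b * s"
    moreover have "\<not> p ^ Suc b dvd p ^ b * s"
      using p by (simp add: prime_gt_0_nat)
    ultimately show "\<not> p ^ Suc b dvd ord x"
      using dvd_trans by blast
  next
    assume nd: "\<not> p ^ Suc b dvd ord x"
    have "ord x dvd p ^ a * s" using ord_dvd_group_order[OF x] ord by simp
    then obtain c d where cd: "ord x = c * d" "c dvd p ^ a" "d dvd s"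
      by (metis division_decomp)
    then obtain i where i: "c = p ^ i" "i \<le> a"
      using p divides_primepow_nat by metis
    have "i \<le> b"
    proof (rule ccontr)
      assume "\<not> i \<le> b"
      then have "p ^ Suc b dvd c"
        unfolding i(1) by (intro le_imp_power_dvd) simp
      then show False using nd cd by (metis dvd_mult2)
    qed
    then show "ord x dvd p ^ b * s"
      using cd i by (simp add: le_imp_power_dvd mult_dvd_mono)
  qed
  then show ?thesis
    by (auto simp: roots_def pow_eq_id)
qed

text \<open>For the factor \<open>s\<close>, class sums over \<open>roots G (p ^ b)\<close> are
  used. For \<open>p ^ b\<close>, the complement of the root set has size divisible by
  \<open>totient (p ^ Suc b) = p ^ b * (p - 1)\<close>.\<close>

lemma (in group) frobenius_prime_power_index:
  assumes fin: "finite (carrier G)" and ord: "order G = p ^ a * s" and b: "b \<le> a"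
    and p: "Factorial_Ring.prime p" "\<not> p dvd s"
  shows "p ^ b * s dvd card (roots G (p ^ b * s))"
proof (rule divides_mult)
  have cop: "coprime (p ^ i) s" for i
    using p by (simp add: prime_imp_coprime)
  then show "coprime (p ^ b) s" .
  have "s dvd (\<Sum>u\<in>roots G (p ^ b). card (roots G s \<inter> centralizer G u))"
  proof (rule dvd_sum_card_roots_centralizer[OF fin ord p roots_sub])
    fix g u assume "g \<in> carrier G" "u \<in> roots G (p ^ b)"
    then show "conj_by G g u \<in> roots G (p ^ b)"
      using conj_by_mem_roots roots_sub by blast
  next
    fix u c t assume u: "u \<in> roots G (p ^ b)" and t: "card (centralizer G u) = p ^ c * t" "\<not> p dvd t"
    have uc: "u \<in> carrier G" using u roots_sub by blast
    interpret C: group "G\<lparr>carrier := centralizer G u\<rparr>"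
      by (rule subgroup_imp_group[OF centralizer_subgroup[OF uc]])
    show "t dvd card (roots G t \<inter> centralizer G u)"
      using p'_part_dvd_card_roots[OF C.group_axioms, of p c t] finite_centralizer[OF fin] t p(1)
        roots_subgroup_eq[OF centralizer_sub] by simp
  qed
  then show "s dvd card (roots G (p ^ b * s))"
    using card_roots_mult_eq_sum[OF fin ord cop le_imp_power_dvd[OF b]] by simp
next
  show "p ^ b dvd card (roots G (p ^ b * s))"
  proof (cases "b = a")
    case True
    then show ?thesis using roots_order ord by (metis dvd_triv_left order_def)
  next
    case False
    then have "b < a" using b by simp
    let ?S = "{x \<in> carrier G. p ^ Suc b dvd ord x}"
    have "p ^ b dvd totient (p ^ Suc b)"
      using p(1) by (simp add: totient_prime_power_Suc del: power_Suc)
    then have "p ^ b dvd card ?S"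
      using totient_dvd_card_ord_multiple[OF fin] dvd_trans by blast
    moreover have "p ^ b dvd card (carrier G)"
      using ord b by (metis dvd_mult2 le_imp_power_dvd order_def)
    moreover have "card (roots G (p ^ b * s)) = card (carrier G) - card ?S"
      using roots_eq_Diff_ord_multiple[OF fin ord \<open>b < a\<close> p] fin by (simp add: card_Diff_subset)
    ultimately show ?thesis by (simp add: dvd_diff_nat)
  qed
qed

subsection \<open>Fusion of \<open>p\<close>-elements\<close>

text \<open>Orbit sizes are powers of \<open>p\<close>; without a fixed point all of them, and so
  \<open>card E\<close>, would be multiples of \<open>p\<close>.\<close>

lemma (in group_action) p_group_fixed_point:
  assumes fin: "finite E" and ord: "order G = p ^ k"
    and p: "Factorial_Ring.prime p" "\<not> p dvd card E"
  shows "\<exists>x\<in>E. \<forall>g\<in>carrier G. \<phi> g x = x"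
proof (rule ccontr)
  assume nfix: "\<not> ?thesis"
  have "p dvd (\<Sum>x\<in>B. 1)" if B: "B \<in> orbits G E \<phi>" for B
  proof -
    have "\<exists>x. B = orbit G \<phi> x \<and> x \<in> E"
      using B unfolding orbits_def by (rule CollectD)
    then obtain x where x: "B = orbit G \<phi> x" "x \<in> E"
      by (elim exE conjE)
    have "card B dvd p ^ k"
      using orbit_stabilizer_theorem[OF x(2)] unfolding x(1) ord by (rule dvdI[OF sym])
    then obtain i where i: "card B = p ^ i"
      using divides_primepow_nat[OF p(1)] by blast
    have "card B \<noteq> 1"
    proof
      assume "card B = 1"
      moreover have "x \<in> B" using orbit_refl[OF x(2)] x(1) by simp
      ultimately have "B = {x}" by (metis card_1_singletonE singletonD)
      then have "\<forall>g\<in>carrier G. \<phi> g x = x"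
        using x(1) unfolding orbit_def by blast
      then show False using nfix x(2) by blast
    qed
    then have "i \<noteq> 0" using i by (metis power_0)
    then show ?thesis using i by simp
  qed
  then have "p dvd (\<Sum>x\<in>E. 1)"
    by (simp only: dvd_sum flip: disjoint_sum[OF fin])
  then show False using p by simp
qed

context group
begin

section \<open>Conjugating \<open>p\<close>-elements into a subgroup of index prime to
  \<open>p\<close>\<close>

lemma action_on_rcosets:
  assumes H: "subgroup H G"
  shows "group_action G (rcosets H) (\<lambda>g. \<lambda>R\<in>rcosets H. R #> inv g)"
proof -
  \<comment> \<open>The inverse restores the order of products, so that right translation becomes a
    homomorphism.\<close>
  let ?\<phi> = "\<lambda>g. \<lambda>R\<in>rcosets H. R #> inv g"
  have Hc: "H \<subseteq> carrier G" by (rule subgroup.subset[OF H])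
  have sub: "R \<subseteq> carrier G" if "R \<in> rcosets H" for R
    using rcosets_part_G[OF H] that by blast
  have closed: "R #> g \<in> rcosets H" if R: "R \<in> rcosets H" and g: "g \<in> carrier G" for R g
  proof -
    obtain a where "a \<in> carrier G" "R = H #> a"
      using R by (auto simp: RCOSETS_def)
    then show ?thesis
      using g Hc rcosetsI[OF Hc, of "a \<otimes> g"] by (simp add: coset_mult_assoc)
  qed
  have bij: "?\<phi> g \<in> Bij (rcosets H)" if g: "g \<in> carrier G" for g
  proof -
    have "bij_betw (?\<phi> g) (rcosets H) (rcosets H)"
      by (rule bij_betw_byWitness [where f' = "\<lambda>R. R #> g"])
        (use g closed sub in \<open>auto simp: coset_mult_assoc\<close>)
    then show ?thesis by (simp add: Bij_def)
  qed
  have "?\<phi> (g \<otimes> h) = compose (rcosets H) (?\<phi> g) (?\<phi> h)" if "g \<in> carrier G" "h \<in> carrier G" for g h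
    using that closed sub by (auto simp: compose_def coset_mult_assoc inv_mult_group fun_eq_iff)
  then have "?\<phi> \<in> hom G (BijGroup (rcosets H))"
    using bij by (auto simp: hom_def BijGroup_def)
  then show ?thesis
    by (simp add: group_action_def group_hom_def group_hom_axioms_def group_BijGroup)
qed

lemma generate_singleton_eq:
  "finite (carrier G) \<Longrightarrow> u \<in> carrier G \<Longrightarrow> generate G {u} = range (\<lambda>k::nat. u [^] k)"
  using generate_pow_on_finite_carrier[of u] by auto

lemma order_eq_card_rcosets_mult: "subgroup H G \<Longrightarrow> order G = card (rcosets H) * card H"
  by (simp add: lagrange)

text \<open>The cyclic \<open>p\<close>-group generated by \<open>x\<close> acts on the
  \<open>s\<close> cosets of \<open>P\<close> and fixes one of them, \<open>P #> a\<close>; then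
  \<open>a\<close> conjugates \<open>x\<close> into \<open>P\<close>.\<close>

lemma p_element_conj_into_subgroup:
  assumes fin: "finite (carrier G)" and ord: "order G = card P * s" and P: "subgroup P G"
    and p: "Factorial_Ring.prime p" "\<not> p dvd s" and x: "x \<in> roots G (p ^ k)"
  shows "\<exists>g\<in>carrier G. conj_by G g x \<in> P"
proof -
  interpret act: group_action G "rcosets P" "\<lambda>g. \<lambda>R\<in>rcosets P. R #> inv g"
    by (rule action_on_rcosets[OF P])
  have xc: "x \<in> carrier G" using x roots_sub by blast
  have Q: "subgroup (generate G {x}) G"
    using xc by (intro generate_is_subgroup) simp
  interpret Q: group_action "G\<lparr>carrier := generate G {x}\<rparr>" "rcosets P" "\<lambda>g. \<lambda>R\<in>rcosets P. R #> inv g"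
    using act.induced_action[OF Q] .
  have "ord x dvd p ^ k"
    using x xc mem_roots_iff_ord_dvd by blast
  then obtain i where "ord x = p ^ i"
    using divides_primepow_nat[OF p(1)] by blast
  then have oQ: "order (G\<lparr>carrier := generate G {x}\<rparr>) = p ^ i"
    using generate_pow_card[OF xc] by simp
  have finR: "finite (rcosets P)"
    using fin subgroup.subset[OF P] by (simp add: RCOSETS_def)
  have "card P > 0"
    using fin P subgroup.finite_imp_card_positive by blast
  then have "card (rcosets P) = s"
    using order_eq_card_rcosets_mult[OF P] ord by simp
  then obtain R where R: "R \<in> rcosets P" and
    "\<forall>g\<in>generate G {x}. (\<lambda>R\<in>rcosets P. R #> inv g) R = R"
    using Q.p_group_fixed_point[OF finR oQ p(1)] p(2) by auto
  then have fix_R: "R #> inv g = R" if "g \<in> generate G {x}" for g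
    using that by simp
  have "inv x \<in> generate G {x}"
    by (rule generate.inv) simp
  then have Rx: "R #> x = R"
    using fix_R xc by force
  obtain a where a: "a \<in> carrier G" "R = P #> a"
    using R by (auto simp: RCOSETS_def)
  have "a \<in> R"
    using rcos_self[OF a(1) P] a(2) by simp
  then have "a \<otimes> x \<in> R #> x"
    by (auto simp: r_coset_def)
  then have "a \<otimes> x \<in> P #> a"
    using Rx a(2) by simp
  then obtain h where h: "h \<in> P" "a \<otimes> x = h \<otimes> a"
    by (auto simp: r_coset_def)
  have "conj_by G a x = h"
    using h a xc subgroup.mem_carrier[OF P h(1)] by (simp add: conj_by_def m_assoc)
  then show ?thesis using a h by blast
qed

text \<open>The index of \<open>P\<close> in \<open>K\<close> divides \<open>s\<close>, so the
  conjugation can be done inside \<open>K\<close>. With \<open>K\<close> a centralizer, the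
  conjugating element leaves a prescribed element fixed.\<close>

lemma p_element_conj_into_subgroup_within:
  assumes fin: "finite (carrier G)" and ord: "order G = card P * s" and P: "subgroup P G"
    and K: "subgroup K G" "P \<subseteq> K"
    and p: "Factorial_Ring.prime p" "\<not> p dvd s" and x: "x \<in> roots G (p ^ k)" "x \<in> K"
  shows "\<exists>g\<in>K. conj_by G g x \<in> P"
proof -
  let ?K = "G\<lparr>carrier := K\<rparr>"
  interpret K: group ?K by (rule subgroup_imp_group[OF K(1)])
  have PK: "subgroup P ?K" by (rule subgroup_incl[OF P K])
  have Kc: "K \<subseteq> carrier G" by (rule subgroup.subset[OF K(1)])
  have "card P dvd card K"
    using K.card_subgroup_dvd[OF PK] by simp
  then obtain t where t: "card K = card P * t" by blast
  obtain r where r: "order G = r * card K" using lagrange[OF K(1)] by metis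
  have "card P > 0"
    using fin P subgroup.finite_imp_card_positive by blast
  then have "s = r * t"
    using ord r t by simp
  then have "\<not> p dvd t" using p(2) by (metis dvd_mult)
  moreover have "x \<in> roots ?K (p ^ k)"
    using x roots_subgroup_eq[OF Kc] by blast
  ultimately obtain g where g: "g \<in> K" "conj_by ?K g x \<in> P"
    using K.p_element_conj_into_subgroup[of P t p x k] PK p(1) t finite_subset[OF Kc fin] by auto
  then have "conj_by ?K g x = conj_by G g x"
    using K(1) by (simp add: conj_by_def)
  then show ?thesis using g by auto
qed

text \<open>Equal order makes \<open>w\<close> another generator of the same cyclic group, so
  \<open>u\<close> is a power of \<open>w\<close>.\<close>

lemma centralizer_generator_sub:
  assumes fin: "finite (carrier G)" and u: "u \<in> carrier G"
    and w: "w \<in> generate G {u}" "ord w = ord u"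
  shows "centralizer G w \<subseteq> centralizer G u"
proof -
  have wc: "w \<in> carrier G"
    using w(1) generate_in_carrier[of "{u}"] u by simp
  have "generate G {w} \<subseteq> generate G {u}"
    using w(1) generate_subgroup_incl[of "{w}" "generate G {u}"] generate_is_subgroup[of "{u}"] u by simp
  moreover have "finite (generate G {u})"
    using generate_incl[of "{u}"] u fin finite_subset by blast
  ultimately have "generate G {w} = generate G {u}"
    using generate_pow_card[OF u] generate_pow_card[OF wc] w(2) card_subset_eq by metis
  moreover have "u \<in> generate G {u}" by (rule generate.incl) simp
  ultimately obtain k :: nat where "u = w [^] k"
    using generate_singleton_eq[OF fin wc] by auto
  then show ?thesis
    using centralizer_pow[OF wc] by simp
qed

lemma conj_by_centralizer_closed:
  assumes "u \<in> carrier G"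
  shows "g \<in> centralizer G u \<Longrightarrow> x \<in> centralizer G u \<Longrightarrow> conj_by G g x \<in> centralizer G u"
  unfolding conj_by_def
  using subgroup.m_closed[OF centralizer_subgroup[OF assms]]
    subgroup.m_inv_closed[OF centralizer_subgroup[OF assms]] by simp

text \<open>Since \<open>u\<close> lies in its own centralizer, the full power of \<open>p\<close>
  divides the order there, and Frobenius' theorem gives at least a fraction \<open>1/p\<close> of
  roots. The factor \<open>p\<close> on the left avoids division.\<close>

lemma card_full_p_part_centralizer:
  assumes fin: "finite (carrier G)" and ord: "order G = p ^ Suc b * s"
    and p: "Factorial_Ring.prime p" "\<not> p dvd s"
    and u: "u \<in> carrier G" "ord u = p ^ Suc b"
  shows "card (centralizer G u - roots G (p ^ b * s)) * p \<le> card (centralizer G u) * (p - 1)"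
proof -
  let ?C = "centralizer G u"
  let ?CG = "G\<lparr>carrier := ?C\<rparr>"
  have sub: "subgroup ?C G" by (rule centralizer_subgroup[OF u(1)])
  interpret C: group ?CG by (rule subgroup_imp_group[OF sub])
  have finC: "finite ?C" using fin by (rule finite_centralizer)
  have "u [^] card ?C = \<one>"
    using C.pow_order_eq_1[of u] u by (simp flip: nat_pow_consistent)
  then have "p ^ Suc b dvd card ?C"
    using u by (simp add: pow_eq_id)
  then obtain t where t: "card ?C = p ^ Suc b * t" by blast
  have "p ^ Suc b * t dvd p ^ Suc b * s"
    using card_subgroup_dvd[OF sub] unfolding t ord .
  then have ts: "t dvd s"
    using p(1) by (simp add: prime_gt_0_nat)
  then have pt: "\<not> p dvd t" using p(2) dvd_trans by blast
  have "card ?C > 0"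
    using finC u(1) by (metis card_gt_0_iff empty_iff self_in_centralizer)
  have "p ^ b * t dvd card (roots ?CG (p ^ b * t))"
    by (rule C.frobenius_prime_power_index[OF _ _ _ p(1) pt, of "Suc b"]) (use finC t in simp_all)
  moreover have "card (roots ?CG (p ^ b * t)) > 0"
  proof -
    have "\<one> \<in> roots ?CG (p ^ b * t)"
      using C.one_closed by (simp add: roots_def flip: nat_pow_consistent)
    then show ?thesis
      using finC roots_subgroup_eq[OF centralizer_sub] card_gt_0_iff by fastforce
  qed
  ultimately have "p ^ b * t \<le> card (roots ?CG (p ^ b * t))"
    by (rule dvd_imp_le)
  also have "\<dots> \<le> card (?C \<inter> roots G (p ^ b * s))"
    using roots_mono[of "p ^ b * t" "p ^ b * s"] ts finC
    by (intro card_mono) (auto simp: roots_subgroup_eq[OF centralizer_sub])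
  finally have le: "p ^ b * t \<le> card (?C \<inter> roots G (p ^ b * s))" .
  have "card (?C - roots G (p ^ b * s)) = p * (p ^ b * t) - card (?C \<inter> roots G (p ^ b * s))"
    using card_Diff_subset_Int[of ?C "roots G (p ^ b * s)"] finC t by (simp add: mult_ac)
  also have "\<dots> \<le> (p - 1) * (p ^ b * t)"
    using le by (simp add: diff_mult_distrib)
  finally have "card (?C - roots G (p ^ b * s)) * p \<le> (p - 1) * (p ^ b * t) * p"
    by simp
  then show ?thesis
    by (simp add: t mult_ac)
qed

text \<open>Every element whose order is divisible by the full power of \<open>p\<close> lies in a conjugate of the
  centralizer of \<open>u\<close>. Counting pairs \<open>(g, x)\<close> with \<open>conj_by G g x\<close> in that centralizer, the
  extremality of the root count leaves no room for the normalizer to exceed the centralizer.\<close>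

lemma extremal_root_count_imp_no_fusion:
  assumes fin: "finite (carrier G)" and ord: "order G = p ^ Suc b * s"
    and p: "Factorial_Ring.prime p" "\<not> p dvd s"
    and ext: "card (roots G (p ^ b * s)) = p ^ b * s"
  obtains u where "u \<in> carrier G" "ord u = p ^ Suc b"
    "\<And>g. g \<in> carrier G \<Longrightarrow> conj_by G g u \<in> generate G {u} \<Longrightarrow> g \<in> centralizer G u"
proof -
  let ?R = "roots G (p ^ b * s)"
  define E where "E = carrier G - ?R"
  have p1: "p > 1" using p(1) by (rule prime_gt_1_nat)
  have n0: "p ^ Suc b * s > 0"
    using fin ord order_gt_0_iff_finite by metis
  have finR: "finite ?R" using fin roots_sub finite_subset by blast
  have cardE: "card E = p ^ b * s * (p - 1)"
    using card_Diff_subset[OF finR roots_sub] ord ext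
    by (simp add: E_def order_def algebra_simps diff_mult_distrib2)
  have E: "x \<in> E \<longleftrightarrow> x \<in> carrier G \<and> p ^ Suc b dvd ord x" for x
    using roots_eq_Diff_ord_multiple[OF fin ord _ p, of b] by (auto simp: E_def)
  \<comment> \<open>This power of \<open>x\<close> is a \<open>p\<close>-element of the largest
    possible order, and it commutes with \<open>x\<close>.\<close>
  have full: "x [^] (ord x div p ^ Suc b) \<in> carrier G" "ord (x [^] (ord x div p ^ Suc b)) = p ^ Suc b"
    if "x \<in> E" for x
  proof -
    have x: "x \<in> carrier G" "p ^ Suc b dvd ord x" using that E by auto
    have pos: "ord x > 0" using ord_ge_1[OF fin x(1)] by simp
    then have "ord x div p ^ Suc b \<noteq> 0"
      using x(2) p1 by (metis dvd_div_eq_0_iff less_not_refl)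
    moreover have "ord x div p ^ Suc b dvd ord x"
      using x(2) by (metis dvd_div_mult_self dvd_triv_left)
    ultimately have "ord (x [^] (ord x div p ^ Suc b)) = ord x div (ord x div p ^ Suc b)"
      using ord_pow[OF x(1)] by blast
    also have "\<dots> = p ^ Suc b"
      using x(2) pos by (metis div_div_eq_right div_mult_self1_is_m div_self dvd_div_mult_self dvd_refl less_not_refl mult.commute nonzero_mult_div_cancel_left)
    finally show "ord (x [^] (ord x div p ^ Suc b)) = p ^ Suc b" .
    show "x [^] (ord x div p ^ Suc b) \<in> carrier G" using x by simp
  qed
  have "card E > 0" using cardE n0 p1 by simp
  then obtain x0 where "x0 \<in> E" by (metis card_gt_0_iff ex_in_conv)
  then obtain u where u: "u \<in> carrier G" "ord u = p ^ Suc b"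
    using full by blast
  let ?C = "centralizer G u" and ?P = "generate G {u}"
  \<comment> \<open>The normalizer of \<open>?C\<close>, which also contains the normalizer of
    \<open>?P\<close>.\<close>
  define N where "N = {g \<in> carrier G. \<forall>c\<in>?C. conj_by G g c \<in> ?C}"
  have P: "subgroup ?P G" "card ?P = p ^ Suc b"
    using generate_is_subgroup[of "{u}"] generate_pow_card[OF u(1)] u by simp_all
  have finC: "finite ?C" using fin by (rule finite_centralizer)
  have CN: "?C \<subseteq> N"
    using conj_by_centralizer_closed[OF u(1)] centralizer_sub by (auto simp: N_def)
  have E_conj: "conj_by G g x \<in> E \<longleftrightarrow> x \<in> E" if "g \<in> carrier G" "x \<in> carrier G" for g x
    using that by (simp add: E ord_conj_by)
  \<comment> \<open>A power \<open>?v\<close> of \<open>x\<close> is conjugate to a generator of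
    \<open>?P\<close>. The same conjugation carries \<open>x\<close>, which commutes with
    \<open>?v\<close>, into \<open>?C\<close>.\<close>
  have into_C: "\<exists>g\<in>carrier G. conj_by G g x \<in> ?C" if x: "x \<in> E" for x
  proof -
    let ?v = "x [^] (ord x div p ^ Suc b)"
    have xc: "x \<in> carrier G" using x E by blast
    note v = full[OF x]
    have "?v \<in> roots G (p ^ Suc b)"
      using v by (simp add: mem_roots_iff_ord_dvd del: power_Suc)
    then obtain g where g: "g \<in> carrier G" "conj_by G g ?v \<in> ?P"
      using p_element_conj_into_subgroup[OF fin _ P(1) p] ord P(2) by metis
    have "x \<in> centralizer G ?v"
      using centralizer_pow[OF xc] self_in_centralizer[OF xc] by blast
    then have "conj_by G g x \<in> centralizer G (conj_by G g ?v)"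
      using conj_by_in_centralizer[OF g(1) xc v(1)] by blast
    also have "\<dots> \<subseteq> ?C"
      using centralizer_generator_sub[OF fin u(1) g(2)] ord_conj_by[OF g(1) v(1)] v(2) u(2) by simp
    finally show ?thesis using g(1) by blast
  qed
  have "(\<Sum>g\<in>carrier G. card {x \<in> E. conj_by G g x \<in> ?C}) = card (E \<inter> ?C) * order G"
  proof -
    \<comment> \<open>\<open>E\<close> is stable under conjugation, so every \<open>g\<close>
      contributes equally.\<close>
    have "card {x \<in> E. conj_by G g x \<in> ?C} = card (E \<inter> ?C)" if g: "g \<in> carrier G" for g
    proof (rule bij_betw_same_card)
      show "bij_betw (conj_by G g) {x \<in> E. conj_by G g x \<in> ?C} (E \<inter> ?C)"
        by (rule bij_betw_byWitness [where f' = "conj_by G (inv g)"])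
          (use g E E_conj in auto)
    qed
    then show ?thesis by (simp add: order_def mult.commute)
  qed
  moreover have "(\<Sum>g\<in>carrier G. card {x \<in> E. conj_by G g x \<in> ?C})
      = (\<Sum>x\<in>E. card {g \<in> carrier G. conj_by G g x \<in> ?C})"
    by (rule sum_multicount_gen) (use fin in \<open>auto simp: E_def\<close>)
  moreover have "card N * card E \<le> (\<Sum>x\<in>E. card {g \<in> carrier G. conj_by G g x \<in> ?C})"
  proof -
    \<comment> \<open>One solution \<open>g0\<close> yields its whole coset under left
      multiplication by \<open>N\<close>.\<close>
    have "card N \<le> card {g \<in> carrier G. conj_by G g x \<in> ?C}" if x: "x \<in> E" for x
    proof -
      have xc: "x \<in> carrier G" using x E by blast
      obtain g0 where g0: "g0 \<in> carrier G" "conj_by G g0 x \<in> ?C"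
        using into_C[OF x] by blast
      show ?thesis
      proof (rule card_inj_on_le)
        show "inj_on (\<lambda>g. g \<otimes> g0) N"
          using g0(1) by (auto simp: inj_on_def N_def)
        show "(\<lambda>g. g \<otimes> g0) ` N \<subseteq> {g \<in> carrier G. conj_by G g x \<in> ?C}"
          using g0 xc by (auto simp: N_def simp flip: conj_by_conj_by)
      qed (use fin in simp)
    qed
    then have "(\<Sum>x\<in>E. card N) \<le> (\<Sum>x\<in>E. card {g \<in> carrier G. conj_by G g x \<in> ?C})"
      by (intro sum_mono)
    then show ?thesis by (simp add: mult.commute)
  qed
  ultimately have "card N * card E \<le> card (E \<inter> ?C) * order G"
    by simp
  also have "E \<inter> ?C = ?C - ?R"
    using centralizer_sub by (auto simp: E_def)
  also have "card (?C - ?R) * order G = (card (?C - ?R) * p) * (p ^ b * s)"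
    by (simp add: ord)
  also have "\<dots> \<le> card ?C * (p - 1) * (p ^ b * s)"
    using card_full_p_part_centralizer[OF fin ord p u] by (rule mult_le_mono1)
  finally have "card N * (p ^ b * s * (p - 1)) \<le> card ?C * (p ^ b * s * (p - 1))"
    by (simp add: cardE mult_ac)
  moreover have "p ^ b * s * (p - 1) > 0" using n0 p1 by simp
  ultimately have "card N \<le> card ?C" by simp
  moreover have "finite N" using fin by (simp add: N_def)
  ultimately have NC: "N = ?C" using CN card_seteq by blast
  \<comment> \<open>An element normalizing \<open>?P\<close> normalizes \<open>?C\<close>, hence
    lies in \<open>N = ?C\<close>.\<close>
  have "g \<in> ?C" if g: "g \<in> carrier G" "conj_by G g u \<in> ?P" for g
  proof -
    have "centralizer G (conj_by G g u) \<subseteq> ?C"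
      using centralizer_generator_sub[OF fin u(1) g(2)] ord_conj_by[OF g(1) u(1)] by simp
    then have "conj_by G g c \<in> ?C" if "c \<in> ?C" for c
      using that conj_by_in_centralizer[OF g(1) _ u(1)] centralizer_sub by blast
    then have "g \<in> N" using g by (simp add: N_def)
    then show ?thesis using NC by simp
  qed
  then show ?thesis using u that by blast
qed

text \<open>Burnside's fusion argument, in the centralizer of \<open>x\<close>.\<close>

lemma commuting_conjugate_p_elements_eq:
  assumes fin: "finite (carrier G)" and ord: "order G = p ^ a * s"
    and p: "Factorial_Ring.prime p" "\<not> p dvd s"
    and u: "u \<in> carrier G" "ord u = p ^ a"
    and fus: "\<And>g. g \<in> carrier G \<Longrightarrow> conj_by G g u \<in> generate G {u} \<Longrightarrow> g \<in> centralizer G u"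
    and x: "x \<in> roots G (p ^ k)" and g: "g \<in> carrier G" and comm: "conj_by G g x \<in> centralizer G x"
  shows "conj_by G g x = x"
proof -
  let ?P = "generate G {u}"
  have P: "subgroup ?P G" "order G = card ?P * s"
    using generate_is_subgroup[of "{u}"] generate_pow_card[OF u(1)] u ord by simp_all
  have xc: "x \<in> carrier G" using x roots_sub by blast
  obtain h where h: "h \<in> carrier G" "conj_by G h x \<in> ?P"
    using p_element_conj_into_subgroup[OF fin P(2,1) p x] by blast
  define x' where "x' = conj_by G h x"
  define y' where "y' = conj_by G h (conj_by G g x)"
  have x': "x' \<in> carrier G" "x' \<in> ?P" using h xc by (auto simp: x'_def)
  let ?K = "centralizer G x'"
  have K: "subgroup ?K G" by (rule centralizer_subgroup[OF x'(1)])
  have cent_P: "centralizer G u \<subseteq> centralizer G w" if w: "w \<in> ?P" for w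
  proof -
    obtain i :: nat where "w = u [^] i"
      using w generate_singleton_eq[OF fin u(1)] by auto
    then show ?thesis using centralizer_pow[OF u(1)] by simp
  qed
  have "u \<in> ?K" using cent_P[OF x'(2)] self_in_centralizer[OF u(1)] by blast
  then have PK: "?P \<subseteq> ?K"
    using generate_subgroup_incl[OF _ K] by simp
  note within = p_element_conj_into_subgroup_within[OF fin P(2,1) K PK p]
  have y': "y' \<in> ?K" "y' \<in> roots G (p ^ k)"
    using comm h g xc x by (auto simp: y'_def x'_def conj_by_in_centralizer conj_by_mem_roots)
  \<comment> \<open>Commutation puts \<open>y'\<close> into \<open>?K\<close>; it can therefore be
    moved into \<open>?P\<close> by an element that fixes \<open>x'\<close>.\<close>
  obtain c where c: "c \<in> ?K" "conj_by G c y' \<in> ?P"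
    using within[OF y'(2,1)] by blast
  have cc: "c \<in> carrier G" using c(1) centralizer_sub by blast
  define y'' where "y'' = conj_by G c y'"
  define g' where "g' = c \<otimes> (h \<otimes> (g \<otimes> inv h))"
  have g': "g' \<in> carrier G" "conj_by G g' x' = y''"
    using cc h g xc by (auto simp: g'_def y''_def y'_def x'_def simp flip: conj_by_conj_by)
  have "u \<in> centralizer G (conj_by G g' x')"
    using cent_P[of y''] c(2) self_in_centralizer[OF u(1)] g'(2) by (auto simp: y''_def)
  \<comment> \<open>As \<open>u\<close> centralizes \<open>y''\<close>, its conjugate under
    \<open>inv g'\<close> centralizes \<open>x'\<close>. Both lie in \<open>?K\<close>, where a
    second conjugation \<open>d\<close> brings the conjugate back into \<open>?P\<close>.\<close>
  then have z: "conj_by G (inv g') u \<in> ?K"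
    using conj_by_in_centralizer[OF g'(1) _ x'(1), of "conj_by G (inv g') u"] g'(1) u(1) by simp
  moreover have "conj_by G (inv g') u \<in> roots G (p ^ a)"
    using u g'(1) by (simp add: mem_roots_iff_ord_dvd ord_conj_by)
  ultimately obtain d where d: "d \<in> ?K" "conj_by G d (conj_by G (inv g') u) \<in> ?P"
    using within by blast
  have dc: "d \<in> carrier G" using d(1) centralizer_sub by blast
  \<comment> \<open>By \<open>fus\<close> this product centralizes \<open>u\<close> and so
    \<open>y''\<close>; but it also sends \<open>y''\<close> to \<open>x'\<close>, forcing
    \<open>y'' = x'\<close>.\<close>
  have "d \<otimes> inv g' \<in> centralizer G u"
    using fus[of "d \<otimes> inv g'"] d(2) dc g'(1) u(1) by (simp add: conj_by_conj_by)
  then have "d \<otimes> inv g' \<in> centralizer G y''"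
    using cent_P[of y''] c(2) by (auto simp: y''_def)
  then have "conj_by G (d \<otimes> inv g') y'' = y''"
    using conj_by_eq_iff[of "d \<otimes> inv g'" y''] dc g' x'(1) by auto
  moreover have "conj_by G (d \<otimes> inv g') y'' = conj_by G d x'"
    using dc g'(1) x'(1) by (simp flip: conj_by_conj_by g'(2))
  moreover have "conj_by G d x' = x'" "conj_by G c x' = x'"
    using conj_by_eq_iff[OF dc x'(1)] conj_by_eq_iff[OF cc x'(1)] d(1) c(1) by simp_all
  ultimately have "conj_by G c y' = conj_by G c x'"
    by (simp add: y''_def)
  then show ?thesis
    using cc h g xc by (simp add: y'_def x'_def conj_by_cancel)
qed

end

subsection \<open>Groups in which commuting conjugates are equal\<close>

text \<open>The quotient \<open>z\<close> of the two commuting conjugates is shown to have order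
  prime to each \<open>p\<close>: their \<open>s\<close>-th powers are commuting conjugate
  \<open>p\<close>-elements, hence equal, so \<open>z [^] s = \<one>\<close>.\<close>

lemma (in group) commuting_conjugates_eq:
  assumes fin: "finite (carrier G)"
    and ext: "\<And>p. Factorial_Ring.prime p \<Longrightarrow> p dvd order G \<Longrightarrow>
      card (roots G (order G div p)) = order G div p"
    and x: "x \<in> carrier G" and g: "g \<in> carrier G" and comm: "conj_by G g x \<in> centralizer G x"
  shows "conj_by G g x = x"
proof -
  define y where "y = conj_by G g x"
  define z where "z = y \<otimes> inv x"
  have y: "y \<in> carrier G" using x g by (simp add: y_def)
  have z: "z \<in> carrier G" using x y by (simp add: z_def)
  have xy: "x \<in> centralizer G y"
    using comm x y centralizer_commute by (simp add: y_def)
  have n0: "order G \<noteq> 0" using fin order_gt_0_iff_finite by simp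
  have "\<not> p dvd ord z" if p: "Factorial_Ring.prime p" and pz: "p dvd ord z" for p
  proof -
    have pn: "p dvd order G"
      using pz ord_dvd_group_order[OF z] dvd_trans by blast
    obtain a s where as: "order G = p ^ a * s" "\<not> p dvd s"
      using multiplicity_decompose'[OF n0, of p] not_prime_unit p by metis
    have "a \<noteq> 0" using as pn by (metis mult_1 power_0)
    then obtain b where b: "a = Suc b" using not0_implies_Suc by blast
    have "order G div p = p ^ b * s"
      using as b p by (simp add: prime_gt_0_nat)
    then have "card (roots G (p ^ b * s)) = p ^ b * s"
      using ext[OF p pn] by simp
    then obtain u where u: "u \<in> carrier G" "ord u = p ^ Suc b"
      "\<And>g. g \<in> carrier G \<Longrightarrow> conj_by G g u \<in> generate G {u} \<Longrightarrow> g \<in> centralizer G u"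
      using extremal_root_count_imp_no_fusion[OF fin as(1)[unfolded b] p as(2)] by blast
    have "x [^] s \<in> roots G (p ^ Suc b)"
      using ord_dvd_group_order[OF x] as(1) b x by (simp add: pow_mem_roots mult.commute)
    moreover have "y [^] s \<in> centralizer G (x [^] s)"
    proof -
      have "x \<in> centralizer G (y [^] s)" using centralizer_pow[OF y] xy by blast
      then have "y [^] s \<in> centralizer G x" using centralizer_commute x y by simp
      then show ?thesis using centralizer_pow[OF x] by blast
    qed
    then have "conj_by G g (x [^] s) \<in> centralizer G (x [^] s)"
      using conj_by_pow[OF g x] by (simp add: y_def)
    ultimately have "conj_by G g (x [^] s) = x [^] s"
      using commuting_conjugate_p_elements_eq[OF fin as(1)[unfolded b] p as(2) u] g by blast
    then have "y [^] s = x [^] s"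
      using conj_by_pow[OF g x] by (simp add: y_def)
    moreover have "y \<otimes> inv x = inv x \<otimes> y"
      using subgroup.m_inv_closed[OF centralizer_subgroup[OF y] xy] by (simp add: centralizer_def)
    then have "z [^] s = y [^] s \<otimes> inv x [^] s"
      unfolding z_def using x y by (intro pow_mult_distrib) auto
    ultimately have "z [^] s = \<one>"
      using x by (simp add: nat_pow_inv)
    then have "ord z dvd s" using z pow_eq_id by simp
    then show ?thesis using as(2) dvd_trans by blast
  qed
  then have "ord z = 1" by (metis prime_factor_nat)
  then have "y \<otimes> inv x = \<one>" using z ord_eq_1 by (simp add: z_def)
  then show ?thesis
    using x y inv_solve_right'[of \<one> y x] by (simp add: y_def)
qed

section \<open>The minimal counterexample and its abelian centralizers\<close>

lemma (in group) centralizer_of_subgroup: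
  "H \<subseteq> carrier G \<Longrightarrow> centralizer (G\<lparr>carrier := H\<rparr>) x = centralizer G x \<inter> H"
  by (auto simp: centralizer_def)

text \<open>In a minimal counterexample centralizers of noncentral elements are abelian, hence they
  partition the noncentral elements, and they are self-normalizing. The conjugates of one of them
  cover at least half of the group but not all noncentral elements; two disjoint such families
  do not fit.\<close>

lemma (in group) abelian_centralizers_imp_abelian:
  assumes fin: "finite (carrier G)"
    and cce: "\<And>x g. x \<in> carrier G \<Longrightarrow> g \<in> carrier G \<Longrightarrow> conj_by G g x \<in> centralizer G x \<Longrightarrow>
      conj_by G g x = x"
    and centr: "\<And>a x y. a \<in> carrier G \<Longrightarrow> centralizer G a \<noteq> carrier G \<Longrightarrow>
      x \<in> centralizer G a \<Longrightarrow> y \<in> centralizer G a \<Longrightarrow> x \<in> centralizer G y"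
    and "a \<in> carrier G"
  shows "centralizer G a = carrier G"
proof -
  let ?C = "centralizer G"
  define Z where "Z = {x \<in> carrier G. ?C x = carrier G}"
  have abel: "\<forall>x\<in>?C a. \<forall>y\<in>?C a. x \<in> ?C y" if "a \<in> carrier G - Z" for a
    using that centr by (auto simp: Z_def)
  have part: "?C b = ?C a" if a: "a \<in> carrier G - Z" and b: "b \<in> ?C a - Z" for a b
  proof
    have bc: "b \<in> carrier G - Z" using b centralizer_sub by blast
    have "a \<in> ?C b" using a b centralizer_commute centralizer_sub by blast
    then show "?C b \<subseteq> ?C a" using abel[OF bc] by blast
    show "?C a \<subseteq> ?C b" using abel[OF a] b by blast
  qed
  have Z_conj: "conj_by G g x \<in> Z \<longleftrightarrow> x \<in> Z" if g: "g \<in> carrier G" and x: "x \<in> carrier G" for g x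
  proof -
    have "card (?C (conj_by G g x)) = card (?C x)"
      using bij_betw_same_card[OF bij_betw_centralizer_conj_by[OF g x]] by simp
    then have "?C (conj_by G g x) = carrier G \<longleftrightarrow> ?C x = carrier G"
      using fin centralizer_sub card_subset_eq by metis
    then show ?thesis using g x by (simp add: Z_def)
  qed
  have "Z = {u \<in> roots G (order G). ?C u = carrier G}"
    by (simp add: Z_def roots_order)
  then have subZ: "subgroup Z G" using central_roots_subgroup by simp
  have finZ: "finite Z" using fin by (simp add: Z_def)
  have Zpos: "card Z > 0" using finZ subgroup.one_closed[OF subZ] card_gt_0_iff by blast
  define S where "S a = {x \<in> carrier G - Z. \<exists>g\<in>carrier G. conj_by G g x \<in> ?C a}" for a
  have count: "order G * (card (?C a) - card Z) = card (S a) * card (?C a)" if a: "a \<in> carrier G - Z" for a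
  proof -
    have ac: "a \<in> carrier G" using a by simp
    have "card {x \<in> S a. conj_by G g x \<in> ?C a} = card (?C a) - card Z" if g: "g \<in> carrier G" for g
    proof -
      have "bij_betw (conj_by G g) {x \<in> S a. conj_by G g x \<in> ?C a} (?C a - Z)"
      proof (rule bij_betw_byWitness [where f' = "conj_by G (inv g)"])
        show "conj_by G (inv g) ` (?C a - Z) \<subseteq> {x \<in> S a. conj_by G g x \<in> ?C a}"
        proof (rule image_subsetI)
          fix y assume y: "y \<in> ?C a - Z"
          then have yc: "y \<in> carrier G" using centralizer_sub by blast
          have "conj_by G g (conj_by G (inv g) y) \<in> ?C a" using y yc g by simp
          moreover have "conj_by G (inv g) y \<in> carrier G - Z" using y yc g Z_conj by simp
          ultimately show "conj_by G (inv g) y \<in> {x \<in> S a. conj_by G g x \<in> ?C a}"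
            using g unfolding S_def by blast
        qed
      qed (use g Z_conj centralizer_sub[of a] in \<open>auto simp: S_def\<close>)
      moreover have "Z \<subseteq> ?C a"
        using ac centralizer_commute by (auto simp: Z_def)
      ultimately show ?thesis
        using card_Diff_subset[OF finZ] bij_betw_same_card by metis
    qed
    moreover have "card {g \<in> carrier G. conj_by G g x \<in> ?C a} = card (?C a)" if x: "x \<in> S a" for x
    proof -
      obtain g0 where g0: "g0 \<in> carrier G" "conj_by G g0 x \<in> ?C a" and xc: "x \<in> carrier G" "x \<notin> Z"
        using x by (auto simp: S_def)
      let ?b = "conj_by G g0 x"
      have b: "?C ?b = ?C a" using part[OF a] g0 xc Z_conj by blast
      \<comment> \<open>Self-normalization: this product sends \<open>?b\<close> to an element of
        the abelian group \<open>?C ?b\<close>, so by \<open>cce\<close> it fixes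
        \<open>?b\<close>.\<close>
      have *: "g \<otimes> inv g0 \<in> ?C a" if g: "g \<in> carrier G" "conj_by G g x \<in> ?C a" for g
      proof -
        have "conj_by G (g \<otimes> inv g0) ?b = conj_by G g x"
          using g g0 xc by (simp flip: conj_by_conj_by)
        then have "conj_by G (g \<otimes> inv g0) ?b = ?b"
          using cce[of ?b "g \<otimes> inv g0"] g g0 xc b by simp
        then show ?thesis
          using conj_by_eq_iff[of "g \<otimes> inv g0" ?b] g g0 xc b by simp
      qed
      have "bij_betw (\<lambda>c. c \<otimes> g0) (?C a) {g \<in> carrier G. conj_by G g x \<in> ?C a}"
      proof (rule bij_betw_byWitness [where f' = "\<lambda>g. g \<otimes> inv g0"])
        show "(\<lambda>c. c \<otimes> g0) ` ?C a \<subseteq> {g \<in> carrier G. conj_by G g x \<in> ?C a}"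
        proof (rule image_subsetI)
          fix c assume c: "c \<in> ?C a"
          then have cc: "c \<in> carrier G" using centralizer_sub by blast
          have "conj_by G (c \<otimes> g0) x = conj_by G c ?b"
            using cc g0 xc by (simp add: conj_by_conj_by)
          then show "c \<otimes> g0 \<in> {g \<in> carrier G. conj_by G g x \<in> ?C a}"
            using conj_by_centralizer_closed[OF ac c g0(2)] cc g0 by simp
        qed
        show "(\<lambda>g. g \<otimes> inv g0) ` {g \<in> carrier G. conj_by G g x \<in> ?C a} \<subseteq> ?C a"
          using * by blast
      qed (use g0 centralizer_sub[of a] in \<open>auto simp: m_assoc\<close>)
      then show ?thesis by (simp add: bij_betw_same_card)
    qed
    moreover have "(\<Sum>g\<in>carrier G. card {x \<in> S a. conj_by G g x \<in> ?C a})
        = (\<Sum>x\<in>S a. card {g \<in> carrier G. conj_by G g x \<in> ?C a})"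
      by (rule sum_multicount_gen) (use fin in \<open>auto simp: S_def\<close>)
    ultimately show ?thesis by (simp add: order_def)
  qed
  \<comment> \<open>By \<open>count\<close>, \<open>card (S a)\<close> is \<open>order G\<close>
    times \<open>1 - card Z / card (?C a)\<close>. The lower bound uses that \<open>card Z\<close>
    is a proper divisor of \<open>card (?C a)\<close>, the upper one that \<open>?C a\<close> is
    proper.\<close>
  have half: "order G \<le> 2 * card (S a)" and small: "card (S a) < order G - card Z"
    if a: "a \<in> carrier G - Z" for a
  proof -
    have ac: "a \<in> carrier G" using a by simp
    have ZC: "Z \<subseteq> ?C a" using ac centralizer_commute by (auto simp: Z_def)
    interpret C: group "G\<lparr>carrier := ?C a\<rparr>"
      by (rule subgroup_imp_group[OF centralizer_subgroup[OF ac]])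
    have "card Z dvd card (?C a)"
      using C.card_subgroup_dvd[OF subgroup_incl[OF subZ centralizer_subgroup[OF ac] ZC]] by simp
    then obtain k where k: "card (?C a) = card Z * k" by blast
    have finC: "finite (?C a)" using fin by (rule finite_centralizer)
    have "Z \<subset> ?C a" using ZC a self_in_centralizer[OF ac] by blast
    then have "card Z < card (?C a)" using finC psubset_card_mono by blast
    then have "card Z * 1 < card Z * k" using k by simp
    then have "1 < k" by (simp only: mult_less_cancel1)
    then have "card Z * 2 \<le> card Z * k" by (intro mult_le_mono2) simp
    then have c2: "2 * card Z \<le> card (?C a)" using k by simp
    have cpos: "card (?C a) > 0" using \<open>card Z < card (?C a)\<close> by simp
    have "order G * card (?C a) \<le> order G * (2 * (card (?C a) - card Z))"
      using c2 by (intro mult_le_mono2) simp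
    also have "\<dots> = 2 * card (S a) * card (?C a)"
      using count[OF a] by simp
    finally show "order G \<le> 2 * card (S a)" using cpos by simp
    have "?C a \<subset> carrier G" using a centralizer_sub[of a] by (auto simp: Z_def)
    then have cn: "card (?C a) < order G" using fin psubset_card_mono by (simp add: order_def)
    have "card (S a) * card (?C a) = order G * card (?C a) - order G * card Z"
      using count[OF a] by (simp add: diff_mult_distrib2)
    also have "\<dots> < order G * card (?C a) - card (?C a) * card Z"
    proof (rule diff_less_mono2)
      show "card (?C a) * card Z < order G * card Z" using cn Zpos by simp
      show "card (?C a) * card Z < order G * card (?C a)"
        using \<open>card Z < card (?C a)\<close> cn cpos by (simp add: mult_less_le_imp_less mult.commute)
    qed
    also have "\<dots> = (order G - card Z) * card (?C a)"
      by (simp add: diff_mult_distrib diff_mult_distrib2 mult.commute)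
    finally show "card (S a) < order G - card Z" by simp
  qed
  have "carrier G \<subseteq> Z"
  proof (rule ccontr)
    assume "\<not> carrier G \<subseteq> Z"
    then obtain a where a: "a \<in> carrier G - Z" by blast
    have GZ: "card (carrier G - Z) = order G - card Z"
      using card_Diff_subset[OF finZ subgroup.subset[OF subZ]] by (simp add: order_def)
    have SG: "S c \<subseteq> carrier G - Z" for c by (auto simp: S_def)
    have "S a \<noteq> carrier G - Z" using small[OF a] GZ by auto
    then obtain b where b: "b \<in> carrier G - Z" "b \<notin> S a" using SG by blast
    \<comment> \<open>A common element would make \<open>?C a\<close> and \<open>?C b\<close>
      conjugate and carry \<open>b\<close> into \<open>?C a\<close>.\<close>
    have "S a \<inter> S b = {}"
    proof (rule ccontr)
      assume "S a \<inter> S b \<noteq> {}"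
      then obtain x g h where x: "x \<in> carrier G" "x \<notin> Z"
        and g: "g \<in> carrier G" "conj_by G g x \<in> ?C a"
        and h: "h \<in> carrier G" "conj_by G h x \<in> ?C b"
        by (auto simp: S_def)
      have Cg: "?C (conj_by G g x) = ?C a" using part[OF a] g x Z_conj by blast
      have Ch: "?C (conj_by G h x) = ?C b" using part[OF b(1)] h x Z_conj by blast
      have bc: "b \<in> carrier G" using b by simp
      have "b \<in> ?C (conj_by G h x)" using Ch self_in_centralizer[OF bc] by simp
      then have "conj_by G (g \<otimes> inv h) b \<in> ?C (conj_by G (g \<otimes> inv h) (conj_by G h x))"
        using g h x bc by (simp add: conj_by_in_centralizer)
      also have "conj_by G (g \<otimes> inv h) (conj_by G h x) = conj_by G g x"
        using g h x by (simp flip: conj_by_conj_by)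
      finally have "b \<in> S a"
        using Cg b(1) g h by (auto simp: S_def)
      then show False using b(2) by simp
    qed
    then have "card (S a) + card (S b) = card (S a \<union> S b)"
      using fin finite_subset[OF SG] by (simp add: card_Un_disjoint)
    also have "\<dots> \<le> order G - card Z"
      using SG fin by (metis GZ Un_least card_mono finite_Diff)
    finally have "card (S a) + card (S b) \<le> order G - card Z" .
    moreover have "order G > 0" using fin order_gt_0_iff_finite by simp
    ultimately show False using half[OF a] half[OF b(1)] Zpos by linarith
  qed
  then show ?thesis using assms(4) by (auto simp: Z_def)
qed

text \<open>Conjugation and centralizers in a subgroup are restrictions of those in
  \<open>G\<close>, so the hypothesis descends; induction makes every proper centralizer
  abelian.\<close>

lemma commuting_conjugates_eq_imp_abelian:
  assumes "group G" "finite (carrier G)"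
    and "\<And>x g. x \<in> carrier G \<Longrightarrow> g \<in> carrier G \<Longrightarrow> conj_by G g x \<in> centralizer G x \<Longrightarrow>
      conj_by G g x = x"
    and "a \<in> carrier G"
  shows "centralizer G a = carrier G"
  using assms
proof (induction "order G" arbitrary: G a rule: less_induct)
  case (less G a0)
  interpret group G by fact
  note fin = less.prems(2) and cce = less.prems(3)
  show ?case
  proof (rule abelian_centralizers_imp_abelian[OF fin cce _ less.prems(4)])
    fix a x y assume a: "a \<in> carrier G" "centralizer G a \<noteq> carrier G"
      and xy: "x \<in> centralizer G a" "y \<in> centralizer G a"
    let ?H = "G\<lparr>carrier := centralizer G a\<rparr>"
    have sub: "subgroup (centralizer G a) G" using a centralizer_subgroup by blast
    have "centralizer G a \<subset> carrier G" using a centralizer_sub[of a] by auto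
    then have "order ?H < order G"
      using fin psubset_card_mono by (simp add: order_def)
    moreover have "conj_by ?H h w = w"
      if "w \<in> carrier ?H" "h \<in> carrier ?H" "conj_by ?H h w \<in> centralizer ?H w" for w h
    proof -
      have wh: "w \<in> centralizer G a" "h \<in> centralizer G a" using that by auto
      then have wh': "w \<in> carrier G" "h \<in> carrier G" using centralizer_sub by blast+
      have "conj_by ?H h w = conj_by G h w"
        using wh sub by (simp add: conj_by_def)
      then show ?thesis
        using that(3) cce[OF wh'] centralizer_of_subgroup[OF centralizer_sub] by auto
    qed
    ultimately have "centralizer ?H y = carrier ?H"
      using less.hyps[OF _ subgroup_imp_group[OF sub]] finite_centralizer[OF fin] xy by simp
    then show "x \<in> centralizer G y"
      using xy centralizer_of_subgroup[OF centralizer_sub] by auto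
  qed
qed

section \<open>Abelian groups with elements of full prime power order\<close>

lemma (in group) ord_mult_coprime:
  assumes x: "x \<in> carrier G" and y: "y \<in> carrier G" and xy: "x \<otimes> y = y \<otimes> x"
    and cop: "coprime (ord x) (ord y)"
  shows "ord (x \<otimes> y) = ord x * ord y"
proof -
  have aux: "ord v dvd k" if v: "v \<in> carrier G" "w \<in> carrier G" and eq: "(v \<otimes> w) [^] k = \<one>"
    and vw: "v \<otimes> w = w \<otimes> v" and cop: "coprime (ord v) (ord w)" for v w and k :: nat
  proof -
    \<comment> \<open>Raising to the power \<open>ord w\<close> eliminates \<open>w\<close> and, by
      coprimality, costs nothing for \<open>v\<close>.\<close>
    have "\<one> = ((v \<otimes> w) [^] k) [^] ord w" using eq by simp
    also have "\<dots> = (v \<otimes> w) [^] (k * ord w)" using v by (simp add: nat_pow_pow)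
    also have "\<dots> = v [^] (k * ord w) \<otimes> w [^] (k * ord w)"
      using v vw by (intro pow_mult_distrib)
    also have "w [^] (k * ord w) = \<one>" using v by (simp add: pow_eq_id)
    finally have "v [^] (k * ord w) = \<one>" using v by simp
    then have "ord v dvd k * ord w" using v by (simp add: pow_eq_id)
    then show ?thesis using cop coprime_dvd_mult_left_iff by blast
  qed
  show ?thesis
  proof (rule dvd_antisym)
    show "ord (x \<otimes> y) dvd ord x * ord y" using ord_mul_divides[OF xy x y] .
    have "(x \<otimes> y) [^] ord (x \<otimes> y) = \<one>" using x y by simp
    then have "ord x dvd ord (x \<otimes> y)" "ord y dvd ord (x \<otimes> y)"
      using aux[OF x y _ xy cop] aux[OF y x _ xy[symmetric]] cop by (simp_all add: xy coprime_commute)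
    then show "ord x * ord y dvd ord (x \<otimes> y)" using cop by (rule divides_mult)
  qed
qed

lemma (in group) cyclic_group_iff_ord:
  assumes fin: "finite (carrier G)"
  shows "cyclic_group G \<longleftrightarrow> (\<exists>x\<in>carrier G. ord x = order G)"
proof -
  have "carrier G = range (\<lambda>n::int. x [^] n) \<longleftrightarrow> ord x = order G" if x: "x \<in> carrier G" for x
  proof -
    have "generate G {x} = range (\<lambda>n::int. x [^] n)"
      using generate_pow[OF x] by auto
    moreover have "generate G {x} \<subseteq> carrier G" using generate_incl x by simp
    ultimately show ?thesis
      using generate_pow_card[OF x] card_subset_eq[OF fin] unfolding order_def by metis
  qed
  then show ?thesis unfolding cyclic_group by blast
qed

text \<open>Exchange argument on an element of maximal order: if a prime \<open>p\<close> still
  divides the index, replacing its \<open>p\<close>-part by \<open>u\<close> increases the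
  order.\<close>

lemma (in group) abelian_full_p_orders_imp_cyclic:
  assumes fin: "finite (carrier G)"
    and comm: "\<And>x y. x \<in> carrier G \<Longrightarrow> y \<in> carrier G \<Longrightarrow> x \<otimes> y = y \<otimes> x"
    and full: "\<And>p. Factorial_Ring.prime p \<Longrightarrow> p dvd order G \<Longrightarrow>
      \<exists>u\<in>carrier G. ord u = p ^ multiplicity p (order G)"
  shows "cyclic_group G"
proof -
  have n0: "order G > 0" using fin order_gt_0_iff_finite by simp
  define m where "m = Max (ord ` carrier G)"
  have "m \<in> ord ` carrier G"
    unfolding m_def using fin one_closed by (intro Max_in) auto
  then obtain x where x: "x \<in> carrier G" "ord x = m" by blast
  have max: "ord y \<le> m" if "y \<in> carrier G" for y
    unfolding m_def using fin that by simp
  have "m = order G"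
  proof (rule ccontr)
    assume "m \<noteq> order G"
    have mn: "m dvd order G" using ord_dvd_group_order[OF x(1)] x(2) by simp
    then obtain l where l: "order G = m * l" by blast
    then have "l \<noteq> 1" using \<open>m \<noteq> order G\<close> by simp
    then obtain p where p: "Factorial_Ring.prime p" "p dvd l" using prime_factor_nat by blast
    have m0: "m \<noteq> 0" "l \<noteq> 0" using l n0 by auto
    obtain i r where ir: "m = p ^ i * r" "\<not> p dvd r"
      using multiplicity_decompose'[OF m0(1), of p] not_prime_unit p(1) by metis
    have "p ^ Suc i dvd order G"
      using l ir(1) p(2) by (auto simp: mult_ac intro: mult_dvd_mono)
    then have i: "Suc i \<le> multiplicity p (order G)"
      using n0 p(1) by (intro multiplicity_geI) (auto simp: not_prime_unit)
    obtain u where u: "u \<in> carrier G" "ord u = p ^ multiplicity p (order G)"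
      using full[OF p(1)] l p(2) by auto
    have p0: "p > 0" using p(1) by (rule prime_gt_0_nat)
    have xi: "ord (x [^] (p ^ i)) = r"
      using ord_pow[OF x(1), of "p ^ i"] x(2) ir p0 by simp
    have "coprime r (p ^ multiplicity p (order G))"
      using ir(2) p(1) by (simp add: coprime_commute prime_imp_coprime)
    then have "ord (x [^] (p ^ i) \<otimes> u) = r * p ^ multiplicity p (order G)"
      using ord_mult_coprime[of "x [^] (p ^ i)" u] x(1) u xi comm by simp
    then have "r * p ^ multiplicity p (order G) \<le> m"
      using max[of "x [^] (p ^ i) \<otimes> u"] x(1) u(1) by simp
    also have "m < r * p ^ Suc i"
      using ir m0 prime_gt_1_nat[OF p(1)] by (simp add: mult.commute)
    also have "\<dots> \<le> r * p ^ multiplicity p (order G)"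
      using i p0 by (intro mult_le_mono2 power_increasing) auto
    finally show False by simp
  qed
  then show ?thesis using cyclic_group_iff_ord[OF fin] x by blast
qed

text \<open>The root counts enter twice: for commutativity and for the elements of full prime power
  order.\<close>

lemma (in group) extremal_root_counts_imp_cyclic:
  assumes fin: "finite (carrier G)"
    and ext: "\<And>p. Factorial_Ring.prime p \<Longrightarrow> p dvd order G \<Longrightarrow>
      card (roots G (order G div p)) = order G div p"
  shows "cyclic_group G"
proof (rule abelian_full_p_orders_imp_cyclic[OF fin])
  fix x y assume xy: "x \<in> carrier G" "y \<in> carrier G"
  have "centralizer G y = carrier G"
    using commuting_conjugates_eq_imp_abelian[OF group_axioms fin commuting_conjugates_eq[OF fin ext]] xy
    by blast
  then show "x \<otimes> y = y \<otimes> x" using xy by (auto simp: centralizer_def)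
next
  fix p assume p: "Factorial_Ring.prime p" "p dvd order G"
  have n0: "order G \<noteq> 0" using fin order_gt_0_iff_finite by simp
  obtain s where s: "order G = p ^ multiplicity p (order G) * s" "\<not> p dvd s"
    using multiplicity_decompose'[OF n0, of p] not_prime_unit p(1) by metis
  obtain b where b: "multiplicity p (order G) = Suc b"
    using p n0 by (metis multiplicity_eq_zero_iff not0_implies_Suc not_prime_unit)
  have "order G div p = p ^ b * s"
    using s(1) p(1) unfolding b by (simp add: prime_gt_0_nat)
  then show "\<exists>u\<in>carrier G. ord u = p ^ multiplicity p (order G)"
    using extremal_root_count_imp_no_fusion[OF fin s(1)[unfolded b] p(1) s(2)] ext[OF p] b by metis
qed

subsection \<open>The product of the element orders\<close>

lemma (in group) card_ord_multiple:
  assumes fin: "finite (carrier G)" and ord: "order G = p ^ a * s" and b: "b < a"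
    and p: "Factorial_Ring.prime p" "\<not> p dvd s"
  shows "card {x \<in> carrier G. p ^ Suc b dvd ord x} = order G - card (roots G (p ^ b * s))"
proof -
  let ?S = "{x \<in> carrier G. p ^ Suc b dvd ord x}"
  have "card (roots G (p ^ b * s)) = card (carrier G) - card ?S"
    unfolding roots_eq_Diff_ord_multiple[OF assms] using fin by (intro card_Diff_subset) auto
  moreover have "card ?S \<le> card (carrier G)" using fin by (intro card_mono) auto
  ultimately show ?thesis by (simp add: order_def)
qed

text \<open>A multiplicity counts the \<open>b < a\<close> with \<open>p ^ Suc b\<close> dividing
  the order; double counting exchanges elements and exponents.\<close>

lemma (in group) sum_multiplicity_ord:
  assumes fin: "finite (carrier G)" and ord: "order G = p ^ a * s"
    and p: "Factorial_Ring.prime p" "\<not> p dvd s"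
  shows "(\<Sum>x\<in>carrier G. multiplicity p (ord x)) = (\<Sum>b<a. order G - card (roots G (p ^ b * s)))"
proof -
  have n0: "order G \<noteq> 0" using fin order_gt_0_iff_finite by simp
  have ma: "multiplicity p (order G) = a"
    using ord p by (intro multiplicity_eqI) (auto simp: prime_gt_0_nat)
  have "multiplicity p (ord x) = card {b \<in> {..<a}. p ^ Suc b dvd ord x}" if x: "x \<in> carrier G" for x
  proof -
    have o: "ord x \<noteq> 0" using ord_ge_1[OF fin x] by simp
    have le: "multiplicity p (ord x) \<le> a"
      using dvd_imp_multiplicity_le[OF ord_dvd_group_order[OF x] n0, of p] ma by metis
    have "p ^ Suc b dvd ord x \<longleftrightarrow> b < multiplicity p (ord x)" for b
    proof -
      have "p ^ Suc b dvd ord x \<longleftrightarrow> Suc b \<le> multiplicity p (ord x)"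
        by (rule power_dvd_iff_le_multiplicity) (use o p(1) not_prime_unit in auto)
      then show ?thesis by (simp add: Suc_le_eq del: power_Suc)
    qed
    then have "{b \<in> {..<a}. p ^ Suc b dvd ord x} = {b \<in> {..<a}. b < multiplicity p (ord x)}"
      by (simp only:)
    also have "\<dots> = {..<multiplicity p (ord x)}"
      using le less_le_trans by blast
    finally have "{b \<in> {..<a}. p ^ Suc b dvd ord x} = {..<multiplicity p (ord x)}" .
    then show ?thesis by simp
  qed
  then have "(\<Sum>x\<in>carrier G. multiplicity p (ord x))
      = (\<Sum>x\<in>carrier G. card {b \<in> {..<a}. p ^ Suc b dvd ord x})"
    by (rule sum.cong[OF refl])
  also have "\<dots> = (\<Sum>b<a. order G - card (roots G (p ^ b * s)))"
    by (rule sum_multicount_gen) (use fin card_ord_multiple[OF fin ord _ p] in \<open>auto simp del: power_Suc\<close>)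
  finally show ?thesis .
qed

text \<open>Indexing by the primes of \<open>n\<close> rather than of \<open>k\<close> gives all
  element orders a common index set, so that products can be swapped.\<close>

lemma prod_prime_powers_eq:
  fixes k n :: nat
  assumes "k dvd n" "n \<noteq> 0"
  shows "(\<Prod>p\<in>prime_factors n. p ^ multiplicity p k) = k"
proof -
  have k: "k \<noteq> 0" using assms by auto
  have "(\<Prod>p\<in>prime_factors n. p ^ multiplicity p k) = (\<Prod>p\<in>prime_factors k. p ^ multiplicity p k)"
  proof (rule prod.mono_neutral_right)
    show "prime_factors k \<subseteq> prime_factors n"
      using assms dvd_prime_factors by blast
    show "\<forall>p\<in>prime_factors n - prime_factors k. p ^ multiplicity p k = 1"
      by (auto simp: prime_factors_multiplicity)
  qed simp
  also have "\<dots> = k" using prod_prime_factors[OF k] by simp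
  finally show ?thesis .
qed

lemma (in group) prod_orders_eq_prod_prime_powers:
  assumes fin: "finite (carrier G)"
  shows "prod_orders G = (\<Prod>p\<in>prime_factors (order G). p ^ (\<Sum>x\<in>carrier G. multiplicity p (ord x)))"
proof -
  have n0: "order G \<noteq> 0" using fin order_gt_0_iff_finite by simp
  have "prod_orders G = (\<Prod>x\<in>carrier G. \<Prod>p\<in>prime_factors (order G). p ^ multiplicity p (ord x))"
    unfolding prod_orders_def using prod_prime_powers_eq[OF ord_dvd_group_order n0]
    by (intro prod.cong) auto
  also have "\<dots> = (\<Prod>p\<in>prime_factors (order G). \<Prod>x\<in>carrier G. p ^ multiplicity p (ord x))"
    by (rule prod.swap)
  finally show ?thesis by (simp add: power_sum)
qed

section \<open>Comparison with a cyclic group\<close>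

lemma (in group) card_roots_ge:
  assumes fin: "finite (carrier G)" and ord: "order G = p ^ a * s" and b: "b \<le> a"
    and p: "Factorial_Ring.prime p" "\<not> p dvd s"
  shows "p ^ b * s \<le> card (roots G (p ^ b * s))"
proof (rule dvd_imp_le[OF frobenius_prime_power_index[OF assms]])
  have "\<one> \<in> roots G (p ^ b * s)" by (simp add: roots_def)
  then show "0 < card (roots G (p ^ b * s))"
    using finite_subset[OF roots_sub fin] card_gt_0_iff by blast
qed

text \<open>A root is a power of the generator whose exponent is a multiple of
  \<open>c = order G div d\<close>, and only \<open>d\<close> such exponents differ modulo
  \<open>order G\<close>.\<close>

lemma (in group) cyclic_card_roots_le:
  assumes fin: "finite (carrier G)" and cyc: "cyclic_group G" and d: "d dvd order G"
  shows "card (roots G d) \<le> d"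
proof -
  obtain x where x: "x \<in> carrier G" "ord x = order G"
    using cyc cyclic_group_iff_ord[OF fin] by blast
  obtain c where c: "order G = d * c" using d by blast
  have pos: "d > 0" "c > 0" using c fin order_gt_0_iff_finite by (metis mult_is_0 neq0_conv)+
  have "generate G {x} = carrier G"
    using generate_pow_card[OF x(1)] x generate_incl[of "{x}"] card_subset_eq[OF fin]
    by (simp add: order_def)
  then have gen: "carrier G = range (\<lambda>k::nat. x [^] k)"
    using generate_singleton_eq[OF fin x(1)] by simp
  have "roots G d \<subseteq> (\<lambda>i. x [^] (c * i)) ` {..<d}"
  proof
    fix y assume y: "y \<in> roots G d"
    then obtain k :: nat where k: "y = x [^] k" using gen roots_sub by blast
    have "x [^] (k * d) = \<one>"
      using y x(1) k by (simp add: roots_def nat_pow_pow)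
    then have "d * c dvd k * d" using x c by (simp add: pow_eq_id)
    then have "c dvd k" using pos by (simp add: mult.commute)
    then obtain i where i: "k = c * i" by blast
    have "[c * i = c * (i mod d)] (mod (order G))"
      unfolding c cong_def by (metis mod_mod_trivial mult.commute mult_mod_right)
    then have "y = x [^] (c * (i mod d))"
      using pow_cong_roots[of x "order G"] x(1) by (simp add: k i roots_order)
    then show "y \<in> (\<lambda>i. x [^] (c * i)) ` {..<d}" using pos by auto
  qed
  then have "card (roots G d) \<le> card ((\<lambda>i. x [^] (c * i)) ` {..<d})"
    by (intro card_mono) auto
  also have "\<dots> \<le> d" using card_image_le[of "{..<d}"] by simp
  finally show ?thesis .
qed

lemma cyclic_integer_mod_group: "cyclic_group (integer_mod_group n)"
proof -
  interpret group "integer_mod_group n" by simp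
  have "carrier (integer_mod_group n) = range (\<lambda>m. m mod int n)"
  proof (cases "n = 0")
    case False
    have "x \<in> range (\<lambda>m. m mod int n)" if "0 \<le> x" "x < int n" for x
      using that by (intro image_eqI[of _ _ x]) auto
    then show ?thesis using False by (auto simp: carrier_integer_mod_group)
  qed (simp add: carrier_integer_mod_group)
  \<comment> \<open>The residue \<open>1 mod int n\<close> also covers the trivial group, where it
    is 0.\<close>
  then have "carrier (integer_mod_group n)
      = range (\<lambda>m::int. (1 mod int n) [^]\<^bsub>integer_mod_group n\<^esub> m)"
    by (simp add: int_pow_integer_mod_group mod_mult_right_eq)
  moreover have "1 mod int n \<in> carrier (integer_mod_group n)"
    by (cases "n = 0") (simp_all add: carrier_integer_mod_group)
  ultimately show ?thesis unfolding cyclic_group by blast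
qed

text \<open>An arbitrary cyclic \<open>C\<close> is allowed so that \<open>G\<close> and
  \<open>C\<close> can trade places when \<open>G\<close> is itself cyclic.\<close>

lemma prod_orders_le_cyclic:
  assumes G: "group G" "finite (carrier G)" and C: "group C" "finite (carrier C)" "cyclic_group C"
    and ord: "order C = order G"
  shows "prod_orders G \<le> prod_orders C"
    and "prod_orders G = prod_orders C \<Longrightarrow> cyclic_group G"
proof -
  interpret G: group G by fact
  interpret C: group C by fact
  let ?n = "order G"
  define eG where "eG p = (\<Sum>x\<in>carrier G. multiplicity p (G.ord x))" for p
  define eC where "eC p = (\<Sum>x\<in>carrier C. multiplicity p (C.ord x))" for p
  have n0: "?n \<noteq> 0" using G(2) G.order_gt_0_iff_finite by simp
  have PG: "prod_orders G = (\<Prod>p\<in>prime_factors ?n. p ^ eG p)"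
    using G.prod_orders_eq_prod_prime_powers[OF G(2)] by (simp add: eG_def)
  have PC: "prod_orders C = (\<Prod>p\<in>prime_factors ?n. p ^ eC p)"
    using C.prod_orders_eq_prod_prime_powers[OF C(2)] by (simp add: eC_def ord)
  \<comment> \<open>The upper bound \<open>?n\<close> on the root counts allows truncated
    subtraction to be undone later.\<close>
  have terms: "\<exists>a s. ?n = p ^ a * s \<and> \<not> p dvd s \<and> (a > 0 \<longleftrightarrow> p dvd ?n) \<and>
      eG p = (\<Sum>b<a. ?n - card (roots G (p ^ b * s))) \<and> eC p = (\<Sum>b<a. ?n - p ^ b * s) \<and>
      (\<forall>b<a. p ^ b * s \<le> card (roots G (p ^ b * s)) \<and> card (roots G (p ^ b * s)) \<le> ?n)"
    if p: "Factorial_Ring.prime p" for p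
  proof -
    obtain a s where as: "?n = p ^ a * s" "\<not> p dvd s"
      using multiplicity_decompose'[OF n0, of p] not_prime_unit p by metis
    have asC: "order C = p ^ a * s" using as(1) ord by simp
    have "card (roots C (p ^ b * s)) = p ^ b * s" if b: "b < a" for b
    proof (rule antisym)
      show "card (roots C (p ^ b * s)) \<le> p ^ b * s"
        using asC b by (intro C.cyclic_card_roots_le[OF C(2,3)]) (simp add: le_imp_power_dvd)
      show "p ^ b * s \<le> card (roots C (p ^ b * s))"
        using C.card_roots_ge[OF C(2) asC _ p as(2)] b by simp
    qed
    then have "eC p = (\<Sum>b<a. ?n - p ^ b * s)"
      using C.sum_multiplicity_ord[OF C(2) asC p as(2)] by (simp add: eC_def ord)
    moreover have "eG p = (\<Sum>b<a. ?n - card (roots G (p ^ b * s)))"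
      using G.sum_multiplicity_ord[OF G(2) as(1) p as(2)] by (simp add: eG_def)
    moreover have "p ^ b * s \<le> card (roots G (p ^ b * s)) \<and> card (roots G (p ^ b * s)) \<le> ?n"
      if "b < a" for b
      using G.card_roots_ge[OF G(2) as(1) _ p as(2)] that card_mono[OF G(2) G.roots_sub]
      by (simp add: order_def)
    moreover have "a > 0 \<longleftrightarrow> p dvd ?n"
      using as by (cases a) auto
    ultimately show ?thesis using as by blast
  qed
  have le: "eG p \<le> eC p" if p: "Factorial_Ring.prime p" for p
  proof -
    obtain a s where "eG p = (\<Sum>b<a. ?n - card (roots G (p ^ b * s)))" "eC p = (\<Sum>b<a. ?n - p ^ b * s)"
      "\<forall>b<a. p ^ b * s \<le> card (roots G (p ^ b * s))"
      using terms[OF p] by blast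
    then show ?thesis by (auto intro!: sum_mono diff_le_mono2)
  qed
  have le': "p ^ eG p \<le> p ^ eC p" if "p \<in> prime_factors ?n" for p
    using le[of p] that by (intro power_increasing) (auto simp: in_prime_factors_iff prime_ge_1_nat)
  show "prod_orders G \<le> prod_orders C"
    unfolding PG PC using le' by (intro prod_mono) auto
  assume eq: "prod_orders G = prod_orders C"
  have eqe: "eG p = eC p" if p: "p \<in> prime_factors ?n" for p
  proof (rule ccontr)
    assume "eG p \<noteq> eC p"
    moreover have pp: "Factorial_Ring.prime p" using p by (simp add: in_prime_factors_iff)
    ultimately have "p ^ eG p < p ^ eC p"
      using le[OF pp] prime_gt_1_nat[OF pp] by (intro power_strict_increasing) auto
    \<comment> \<open>Positivity of the remaining factors keeps one strict inequality strict in the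
      product.\<close>
    moreover have "0 < (\<Prod>q\<in>prime_factors ?n - {p}. q ^ eG q)"
      by (intro prod_pos) (auto simp: in_prime_factors_iff prime_gt_0_nat)
    moreover have "(\<Prod>q\<in>prime_factors ?n - {p}. q ^ eG q) \<le> (\<Prod>q\<in>prime_factors ?n - {p}. q ^ eC q)"
      using le' by (intro prod_mono) auto
    ultimately have "p ^ eG p * (\<Prod>q\<in>prime_factors ?n - {p}. q ^ eG q)
        < p ^ eC p * (\<Prod>q\<in>prime_factors ?n - {p}. q ^ eC q)"
      by (intro mult_less_le_imp_less) auto
    then have "prod_orders G < prod_orders C"
      unfolding PG PC using p by (simp add: prod.remove)
    then show False using eq by simp
  qed
  show "cyclic_group G"
  proof (rule G.extremal_root_counts_imp_cyclic[OF G(2)])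
    fix p assume p: "Factorial_Ring.prime p" "p dvd ?n"
    obtain a s where as: "?n = p ^ a * s" "a > 0"
      and e: "eG p = (\<Sum>b<a. ?n - card (roots G (p ^ b * s)))" "eC p = (\<Sum>b<a. ?n - p ^ b * s)"
      and ge: "\<And>b. b < a \<Longrightarrow> p ^ b * s \<le> card (roots G (p ^ b * s))"
        "\<And>b. b < a \<Longrightarrow> card (roots G (p ^ b * s)) \<le> ?n"
      using terms[OF p(1)] p(2) by blast
    obtain c where c: "a = Suc c" using as(2) gr0_implies_Suc by blast
    have "eG p = eC p" using eqe p n0 by (simp add: in_prime_factors_iff)
    have sums: "(\<Sum>b<a. ?n - card (roots G (p ^ b * s))) = (\<Sum>b<a. ?n - p ^ b * s)"
      using e \<open>eG p = eC p\<close> by simp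
    \<comment> \<open>Equal sums with termwise inequality agree in each term; the last index
      \<open>c\<close> belongs to \<open>?n div p\<close>.\<close>
    have "?n - card (roots G (p ^ c * s)) = ?n - p ^ c * s"
      using ge(1) c by (intro sum_mono_inv[OF sums, of c]) (auto intro: diff_le_mono2)
    then have "card (roots G (p ^ c * s)) = p ^ c * s"
      using ge[of c] c by simp
    moreover have "?n div p = p ^ c * s"
      using as(1) c p(1) by (simp add: prime_gt_0_nat)
    ultimately show "card (roots G (?n div p)) = ?n div p" by simp
  qed
qed

theorem theorem1p3:
  fixes G :: "('a, 'b) monoid_scheme"
  assumes "group G" and "finite (carrier G)"
  shows "prod_orders G \<le> prod_orders (integer_mod_group (order G)) \<and>
         (prod_orders G = prod_orders (integer_mod_group (order G)) \<longleftrightarrow> cyclic_group G)"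
proof -
  let ?C = "integer_mod_group (order G)"
  interpret group G by fact
  have n0: "order G > 0" using assms(2) order_gt_0_iff_finite by simp
  have C: "group ?C" "finite (carrier ?C)" "cyclic_group ?C" "order ?C = order G"
    using n0 cyclic_integer_mod_group by (auto simp: carrier_integer_mod_group order_def)
  note le = prod_orders_le_cyclic[OF assms C]
  \<comment> \<open>The comparison with the two groups interchanged.\<close>
  moreover have "prod_orders ?C \<le> prod_orders G" if "cyclic_group G"
    using prod_orders_le_cyclic(1)[OF C(1,2) assms that C(4)[symmetric]] .
  ultimately show ?thesis by (meson antisym)
qed

end
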